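(* Let $K=K(n)$ be positive integers with $K\to\infty$ and $n/K\to 0$ as $n\to\infty$, and let the initial law $\mu_K$ of the walk $Y_K$ be the uniform law on $V_K$. Then for every $s\ge 1$, all $0\leq t_1<\dots<t_s$ and every smooth compactly supported function $\varphi\in\mathcal{C}_c^\infty(\mathbb{R}^s,\mathbb{R})$, \[\sqrt{2\pi\frac{K}{n}}\;\mathbb{E}\left[\varphi\left(Z_{n,K}(t_1),\Delta Z_{n,K}(t_2),\dots,\Delta Z_{n,K}(t_s)\right)\right]\underset{n\to\infty}{\longrightarrow}\int_{\mathbb{R}}\mathbb{E}\left[\varphi\left(x,2W_{t_2},\dots,2W_{t_s}\right)\right]dx,\] where $(W_t)_{t\geq 0}$ is a standard Brownian motion starting from $0$.
   Context: For $K\ge 1$, $V_K=\{-1,+1\}^K$ is the vertex set of the $K$-dimensional hypercube, in which two vertices are adjacent iff they differ in exactly one coordinate. $(Y_K(i))_{i\ge 0}$ is the simple random walk on this graph (at each step a uniformly chosen coordinate, independent of the past, changes sign), started from the law $\mu_K$ on $V_K$. $f_K(v)=\sum_{i=1}^K v^{(i)}$ for $v\in V_K$, and for $t\ge0$: $X_{n,K}(t)=f_K(Y_K(\lfloor nt\rfloor))$, $Z_{n,K}(t)=n^{-1/2}X_{n,K}(t)$, $\Delta Z_{n,K}(t)=Z_{n,K}(t)-Z_{n,K}(0)$. *)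

theory Defs
  imports "HOL-Probability.Probability"
begin

definition hypercube :: "nat \<Rightarrow> (nat \<Rightarrow> real) set" where
  "hypercube K = {1..K} \<rightarrow>\<^sub>E {-1, 1}"

definition hypercube_adj :: "nat \<Rightarrow> (nat \<Rightarrow> real) \<Rightarrow> (nat \<Rightarrow> real) \<Rightarrow> bool" where
  "hypercube_adj K v w \<longleftrightarrow>
     v \<in> hypercube K \<and> w \<in> hypercube K \<and> (\<exists>!c. c \<in> {1..K} \<and> v c \<noteq> w c)"

definition flip :: "nat \<Rightarrow> (nat \<Rightarrow> real) \<Rightarrow> (nat \<Rightarrow> real)" where
  "flip c v = v(c := - v c)"

lemma hypercube_adj_iff_flip:
  assumes "v \<in> hypercube K"
  shows "hypercube_adj K v w \<longleftrightarrow> (\<exists>c\<in>{1..K}. w = flip c v)"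
proof
  assume adj: "hypercube_adj K v w"
  then obtain c where c: "c \<in> {1..K}" "v c \<noteq> w c"
    and uniq: "\<And>d. d \<in> {1..K} \<Longrightarrow> v d \<noteq> w d \<Longrightarrow> d = c"
    unfolding hypercube_adj_def by blast
  have w: "w \<in> {1..K} \<rightarrow>\<^sub>E {-1, 1}" and v: "v \<in> {1..K} \<rightarrow>\<^sub>E {-1, 1}"
    using adj by (simp_all only: hypercube_adj_def hypercube_def)
  have "w c = - v c"
    using PiE_mem[OF w c(1)] PiE_mem[OF v c(1)] c(2) by fastforce
  moreover have "w d = v d" if "d \<noteq> c" for d
    using uniq[of d] PiE_arb[OF v, of d] PiE_arb[OF w, of d] that by metis
  ultimately have "w = flip c v" by (auto simp: flip_def)
  then show "\<exists>c\<in>{1..K}. w = flip c v" using c(1) by blast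
next
  assume "\<exists>c\<in>{1..K}. w = flip c v"
  then obtain c where c: "c \<in> {1..K}" and w: "w = flip c v" by blast
  have v: "v \<in> {1..K} \<rightarrow>\<^sub>E {-1, 1}" using assms by (simp only: hypercube_def)
  have vc: "v c = -1 \<or> v c = 1" using PiE_mem[OF v c] by blast
  have "w \<in> {1..K} \<rightarrow>\<^sub>E {-1, 1}"
  proof (rule PiE_I)
    fix d assume "d \<in> {1..K}"
    then show "w d \<in> {-1, 1}" using PiE_mem[OF v, of d] vc
      by (cases "d = c") (auto simp only: w flip_def fun_upd_apply simp_thms if_True if_False
        insert_iff empty_iff minus_minus)
  next
    fix d assume "d \<notin> {1..K}"
    then show "w d = undefined" using PiE_arb[OF v, of d] c by (metis w flip_def fun_upd_apply)
  qed
  moreover have "\<exists>!d. d \<in> {1..K} \<and> v d \<noteq> w d"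
  proof (rule ex1I)
    show "c \<in> {1..K} \<and> v c \<noteq> w c" using c vc by (auto simp: w flip_def)
    show "d = c" if "d \<in> {1..K} \<and> v d \<noteq> w d" for d
      using that by (metis w flip_def fun_upd_apply)
  qed
  ultimately show "hypercube_adj K v w"
    using assms by (simp only: hypercube_adj_def hypercube_def)
qed

text \<open>
  \<open>C i\<close> is the coordinate flipped at step \<open>i\<close>. Independence of the past is stated for the
  generated sigma-algebras because the library's \<open>indep_var\<close> only relates random variables
  with values in the same type.
\<close>

definition hypercube_walk ::
  "'a measure \<Rightarrow> nat \<Rightarrow> (nat \<Rightarrow> real) measure \<Rightarrow> (nat \<Rightarrow> 'a \<Rightarrow> (nat \<Rightarrow> real)) \<Rightarrow> bool" where
  "hypercube_walk M K \<mu> Y \<longleftrightarrow>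
     prob_space M \<and>
     (\<forall>i. Y i \<in> M \<rightarrow>\<^sub>M count_space (hypercube K)) \<and>
     distr M (count_space (hypercube K)) (Y 0) = \<mu> \<and>
     (\<exists>C. \<forall>i.
        C i \<in> M \<rightarrow>\<^sub>M count_space {1..K} \<and>
        distr M (count_space {1..K}) (C i) = uniform_count_measure {1..K} \<and>
        prob_space.indep_set M
          (sets (vimage_algebra (space M) (C i) (count_space {1..K})))
          (sets (vimage_algebra (space M) (\<lambda>\<omega>. \<lambda>j\<in>{..i}. Y j \<omega>)
             (Pi\<^sub>M {..i} (\<lambda>_. count_space (hypercube K))))) \<and>
        (\<forall>\<omega>\<in>space M. Y (Suc i) \<omega> = flip (C i \<omega>) (Y i \<omega>)))"

definition coord_sum :: "nat \<Rightarrow> (nat \<Rightarrow> real) \<Rightarrow> real" where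
  "coord_sum K v = (\<Sum>i=1..K. v i)"

definition walk_X :: "(nat \<Rightarrow> nat \<Rightarrow> 'a \<Rightarrow> (nat \<Rightarrow> real)) \<Rightarrow> nat \<Rightarrow> nat \<Rightarrow> real \<Rightarrow> 'a \<Rightarrow> real" where
  "walk_X Y n K t \<omega> = coord_sum K (Y K (nat \<lfloor>real n * t\<rfloor>) \<omega>)"

definition walk_Z :: "(nat \<Rightarrow> nat \<Rightarrow> 'a \<Rightarrow> (nat \<Rightarrow> real)) \<Rightarrow> nat \<Rightarrow> nat \<Rightarrow> real \<Rightarrow> 'a \<Rightarrow> real" where
  "walk_Z Y n K t \<omega> = walk_X Y n K t \<omega> / sqrt (real n)"

definition walk_dZ :: "(nat \<Rightarrow> nat \<Rightarrow> 'a \<Rightarrow> (nat \<Rightarrow> real)) \<Rightarrow> nat \<Rightarrow> nat \<Rightarrow> real \<Rightarrow> 'a \<Rightarrow> real" where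
  "walk_dZ Y n K t \<omega> = walk_Z Y n K t \<omega> - walk_Z Y n K 0 \<omega>"

definition standard_brownian_motion :: "'b measure \<Rightarrow> (real \<Rightarrow> 'b \<Rightarrow> real) \<Rightarrow> bool" where
  "standard_brownian_motion N W \<longleftrightarrow>
     prob_space N \<and>
     (\<forall>t\<ge>0. W t \<in> borel_measurable N) \<and>
     (AE \<omega> in N. W 0 \<omega> = 0) \<and>
     (\<forall>r t. 0 \<le> r \<and> r < t \<longrightarrow>
        distributed N lborel (\<lambda>\<omega>. W t \<omega> - W r \<omega>) (normal_density 0 (sqrt (t - r)))) \<and>
     (\<forall>m (u :: nat \<Rightarrow> real). 0 \<le> u 0 \<and> strict_mono_on {..m} u \<longrightarrow>
        prob_space.indep_vars N (\<lambda>_. borel) (\<lambda>j \<omega>. W (u (Suc j)) \<omega> - W (u j) \<omega>) {..<m}) \<and>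
     (AE \<omega> in N. continuous_on {0..} (\<lambda>t. W t \<omega>))"

primrec C_k :: "nat \<Rightarrow> ('a::euclidean_space \<Rightarrow> real) \<Rightarrow> bool" where
  "C_k 0 f \<longleftrightarrow> continuous_on UNIV f"
| "C_k (Suc k) f \<longleftrightarrow>
     (\<forall>x. f differentiable at x) \<and> (\<forall>v. C_k k (\<lambda>x. frechet_derivative f (at x) v))"

definition smooth_compact_support :: "('a::euclidean_space \<Rightarrow> real) \<Rightarrow> bool" where
  "smooth_compact_support f \<longleftrightarrow> (\<forall>k. C_k k f) \<and> compact (closure {x. f x \<noteq> 0})"

end

theory Submission
  imports Defs "HOL-Real_Asymp.Real_Asymp"
begin

text \<open>
  Write \<open>X\<^sub>i\<close> for the coordinate sum after \<open>i\<close> steps. The argument of \<open>\<phi>\<close> is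
  \<open>n\<^sup>-\<^sup>1\<^sup>/\<^sup>2 (X\<^sub>0 b + \<Sum>\<^sub>j (X\<^sub>j\<^sub>+\<^sub>1 - X\<^sub>j) e\<^sub>j)\<close> with deterministic vectors \<open>b\<close>, \<open>e\<^sub>j\<close> having entries 0 and 1.
  Given the past, \<open>X\<^sub>j\<^sub>+\<^sub>1 - X\<^sub>j\<close> is \<open>\<plusminus>2\<close> with mean \<open>-2 X\<^sub>j / K\<close>. Condition on \<open>X\<^sub>0 = k\<close> with
  \<open>k = O(\<surd>n)\<close>: then \<open>X\<^sub>j = O(\<surd>n)\<close> in mean, so a Lindeberg exchange replaces the
  steps one by one by the Brownian increments \<open>2 (W((j+1)/n) - W(j/n))\<close> at total cost
  \<open>O(n/K + n\<^sup>-\<^sup>1\<^sup>/\<^sup>2)\<close>. The level \<open>k\<close> has probability about \<open>2 / \<surd>(2 \<pi> K)\<close>,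
  so the sum over all levels, which are spaced by 2, is a Riemann sum with mesh
  \<open>2 / \<surd>n\<close>. It converges by dominated convergence, because returning from \<open>X\<^sub>0 = k\<close> to
  the support of \<open>\<phi>\<close> has probability \<open>O(1 / (1 + k\<^sup>2/n))\<close>. Translation invariance of Lebesgue
  measure turns \<open>x + 2 W(t\<^sub>1)\<close> into \<open>x\<close>.
\<close>

subsection \<open>Local limit theorem for binomial coefficients\<close>

lemma gbinomial_minus_half: "(- 1 / 2 :: real) gchoose n = (- 1) ^ n * (real ((2 * n) choose n) / 4 ^ n)"
proof -
  have "real ((2 * n) choose n) = fact (2 * n) / (fact n * fact n)"
    by (simp add: binomial_fact)
  also have "\<dots> = 4 ^ n * pochhammer (1 / 2) n / fact n"
    by (simp add: fact_double power_mult)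
  finally show ?thesis
    by (simp add: gbinomial_pochhammer)
qed

lemma central_binomial_asymp:
  "(\<lambda>m. sqrt (real m) * (real ((2 * m) choose m) / 4 ^ m)) \<longlonglongrightarrow> 1 / sqrt pi"
proof (rule Lim_transform_eventually)
  show "(\<lambda>m. ((- 1 / 2) gchoose m) / ((- 1) ^ m / exp ((- 1 / 2 + 1) * ln (real m)))) \<longlonglongrightarrow> 1 / sqrt pi"
    using gbinomial_asymptotic[of "- 1 / 2 :: real"] by (simp add: Gamma_one_half_real field_simps)
  show "\<forall>\<^sub>F m in sequentially. ((- 1 / 2) gchoose m) / ((- 1) ^ m / exp ((- 1 / 2 + 1) * ln (real m)))
      = sqrt (real m) * (real ((2 * m) choose m) / 4 ^ m)"
    using eventually_gt_at_top[of 0]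
  proof eventually_elim
    case (elim m)
    then have "exp ((- 1 / 2 + 1) * ln (real m)) = sqrt (real m)"
      by (simp add: powr_half_sqrt[symmetric] powr_def)
    then show ?case
      unfolding gbinomial_minus_half by (simp add: field_simps)
  qed
qed

lemma binomial_half_eq_central:
  "real (K choose (K div 2)) / 2 ^ K = real ((2 * ((K + 1) div 2)) choose ((K + 1) div 2)) / 4 ^ ((K + 1) div 2)"
proof (cases "even K")
  case True
  then show ?thesis by (auto simp: power_mult elim!: evenE)
next
  case False
  then obtain m where K_eq: "K = 2 * m + 1" by (auto elim: oddE)
  have "(2 * Suc m) choose Suc m = 2 * (K choose m)"
    using central_binomial_odd[OF False] by (simp add: K_eq)
  then show ?thesis by (simp add: K_eq power_mult)
qed

definition scaled_binomial :: "nat \<Rightarrow> nat \<Rightarrow> real" where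
  "scaled_binomial K j = sqrt (pi * real K / 2) * (real (K choose j) / 2 ^ K)"

lemma scaled_binomial_nonneg: "0 \<le> scaled_binomial K j"
  by (simp add: scaled_binomial_def)

lemma scaled_binomial_le_half: "scaled_binomial K j \<le> scaled_binomial K (K div 2)"
  unfolding scaled_binomial_def
  by (intro mult_left_mono divide_right_mono) (auto simp: binomial_maximum)

lemma scaled_binomial_half_tendsto: "(\<lambda>K. scaled_binomial K (K div 2)) \<longlonglongrightarrow> 1"
proof -
  define h where "h K = (K + 1) div 2" for K :: nat
  have h_lim: "filterlim h at_top sequentially"
    unfolding h_def by real_asymp
  have ratio: "(\<lambda>K. real K / (2 * real (h K))) \<longlonglongrightarrow> 1"
  proof (rule tendsto_sandwich)
    show "\<forall>\<^sub>F K in sequentially. real K / (real K + 1) \<le> real K / (2 * real (h K))"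
    proof (rule eventually_sequentiallyI[of 1])
      fix K :: nat assume "1 \<le> K"
      then have "0 < 2 * real (h K)" "2 * real (h K) \<le> real K + 1" unfolding h_def by linarith+
      then show "real K / (real K + 1) \<le> real K / (2 * real (h K))"
        by (intro divide_left_mono) auto
    qed
    have "real K \<le> 2 * real (h K)" for K unfolding h_def by linarith
    then show "\<forall>\<^sub>F K in sequentially. real K / (2 * real (h K)) \<le> 1"
      by (intro always_eventually allI divide_le_eq_1[THEN iffD2]) (auto simp: not_less)
  qed real_asymp+
  have "scaled_binomial K (K div 2)
      = sqrt pi * sqrt (real K / (2 * real (h K))) * (sqrt (real (h K)) * (real ((2 * h K) choose h K) / 4 ^ h K))"
    for K
    by (cases "K = 0") (auto simp: scaled_binomial_def binomial_half_eq_central h_def real_sqrt_mult real_sqrt_divide)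
  moreover have "(\<lambda>K. sqrt pi * sqrt (real K / (2 * real (h K))) * (sqrt (real (h K)) * (real ((2 * h K) choose h K) / 4 ^ h K)))
      \<longlonglongrightarrow> sqrt pi * sqrt 1 * (1 / sqrt pi)"
    by (intro tendsto_intros ratio filterlim_compose[OF central_binomial_asymp h_lim])
  ultimately show ?thesis by simp
qed

lemma binomial_diff_Suc_le:
  assumes "K div 2 \<le> j" "j < K"
  shows "real (K choose j) - real (K choose Suc j)
    \<le> 2 * (2 * real j + 1 - real K) / real K * real (K choose (K div 2))"
proof -
  have "Suc j * (K choose Suc j) = (K - j) * (K choose j)"
    using binomial_absorb_comp[of K j] binomial_absorption[of j K] by simp
  then have "real (Suc j) * real (K choose Suc j) = (real K - real j) * real (K choose j)"
    using assms(2) by (simp only: flip: of_nat_mult of_nat_diff[OF less_imp_le])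
  then have "real (K choose j) - real (K choose Suc j)
      = (2 * real j + 1 - real K) / (real j + 1) * real (K choose j)"
    by (simp add: field_simps)
  also have "\<dots> \<le> 2 * (2 * real j + 1 - real K) / real K * real (K choose (K div 2))"
  proof (rule mult_mono)
    have "real K \<le> 2 * real j + 1" using assms(1) by linarith
    moreover from this have "(2 * real j + 1 - real K) * real K \<le> (2 * real j + 1 - real K) * (2 * (real j + 1))"
      by (intro mult_left_mono) auto
    ultimately show "(2 * real j + 1 - real K) / (real j + 1) \<le> 2 * (2 * real j + 1 - real K) / real K"
      and "0 \<le> 2 * (2 * real j + 1 - real K) / real K"
      using assms(2) by (auto simp: field_simps)
  qed (auto simp: binomial_maximum)
  finally show ?thesis .
qed

lemma binomial_ge_above_half:
  assumes "K div 2 \<le> j" "j \<le> K"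
  shows "(1 - (2 * real j - real K)\<^sup>2 / real K) * real (K choose (K div 2)) \<le> real (K choose j)"
  using assms
proof (induction j rule: dec_induct)
  case base
  show ?case by (simp add: mult_left_le_one_le algebra_simps)
next
  case (step j)
  define x a where "x = 2 * real j - real K" and "a = real (K choose (K div 2))"
  have "x \<ge> - 1" using step.hyps unfolding x_def by linarith
  then have "x\<^sup>2 + 2 * (x + 1) \<le> (x + 2)\<^sup>2" by (simp add: power2_eq_square algebra_simps)
  then have "x\<^sup>2 / real K + 2 * (x + 1) / real K \<le> (x + 2)\<^sup>2 / real K"
    by (simp add: divide_right_mono flip: add_divide_distrib)
  then have "(1 - (x + 2)\<^sup>2 / real K) * a \<le> (1 - x\<^sup>2 / real K - 2 * (x + 1) / real K) * a"
    by (intro mult_right_mono) (auto simp: a_def)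
  also have "\<dots> = (1 - x\<^sup>2 / real K) * a - 2 * (x + 1) / real K * a"
    by (simp add: left_diff_distrib)
  also have "\<dots> \<le> real (K choose Suc j)"
  proof -
    have "real (K choose j) - real (K choose Suc j) \<le> 2 * (x + 1) / real K * a"
      using binomial_diff_Suc_le[of K j] step by (simp add: x_def a_def algebra_simps)
    moreover have "(1 - x\<^sup>2 / real K) * a \<le> real (K choose j)"
      using step by (simp add: x_def a_def)
    ultimately show ?thesis by linarith
  qed
  finally show ?case by (simp add: x_def a_def algebra_simps)
qed

lemma binomial_ge:
  assumes "j \<le> K"
  shows "(1 - (2 * real j - real K)\<^sup>2 / real K) * real (K choose (K div 2)) \<le> real (K choose j)"
proof (cases "K div 2 \<le> j")
  case True
  then show ?thesis using binomial_ge_above_half assms by blast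
next
  case False
  have "(2 * real (K - j) - real K)\<^sup>2 = (2 * real j - real K)\<^sup>2"
    using assms by (simp add: of_nat_diff power2_eq_square algebra_simps)
  then show ?thesis
    using binomial_ge_above_half[of K "K - j"] False assms by (simp add: binomial_symmetric[of j K])
qed

lemma scaled_binomial_tendsto:
  assumes K_lim: "filterlim K at_top F" and j_le: "\<forall>\<^sub>F n in F. j n \<le> K n"
    and deviation: "((\<lambda>n. (2 * real (j n) - real (K n))\<^sup>2 / real (K n)) \<longlongrightarrow> 0) F"
  shows "((\<lambda>n. scaled_binomial (K n) (j n)) \<longlongrightarrow> 1) F"
proof -
  let ?lower = "\<lambda>n. (1 - (2 * real (j n) - real (K n))\<^sup>2 / real (K n)) * scaled_binomial (K n) (K n div 2)"
  have half: "((\<lambda>n. scaled_binomial (K n) (K n div 2)) \<longlongrightarrow> 1) F"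
    by (rule filterlim_compose[OF scaled_binomial_half_tendsto K_lim])
  show ?thesis
  proof (rule tendsto_sandwich[OF _ _ _ half])
    show "(?lower \<longlongrightarrow> 1) F"
      using tendsto_mult[OF tendsto_diff[OF tendsto_const deviation] half, of 1] by simp
    show "\<forall>\<^sub>F n in F. ?lower n \<le> scaled_binomial (K n) (j n)"
      using j_le
    proof eventually_elim
      case (elim n)
      have "sqrt (pi * real (K n) / 2)
          * ((1 - (2 * real (j n) - real (K n))\<^sup>2 / real (K n)) * real (K n choose (K n div 2)) / 2 ^ K n)
        \<le> scaled_binomial (K n) (j n)"
        unfolding scaled_binomial_def by (intro mult_left_mono divide_right_mono binomial_ge elim) auto
      then show ?case by (simp add: scaled_binomial_def mult_ac)
    qed
  qed (simp add: scaled_binomial_le_half)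
qed

lemma scaled_binomial_rescaled_tendsto:
  fixes K j :: "nat \<Rightarrow> nat"
  assumes K_lim: "filterlim K at_top sequentially" and j_le: "\<forall>\<^sub>F n in sequentially. j n \<le> K n"
    and nK_lim: "(\<lambda>n. real n / real (K n)) \<longlonglongrightarrow> 0"
    and x_lim: "(\<lambda>n. (2 * real (j n) - real (K n)) / sqrt (real n)) \<longlonglongrightarrow> x"
  shows "(\<lambda>n. scaled_binomial (K n) (j n)) \<longlonglongrightarrow> 1"
proof (rule scaled_binomial_tendsto[OF K_lim j_le])
  have "(\<lambda>n. ((2 * real (j n) - real (K n)) / sqrt (real n))\<^sup>2 * (real n / real (K n))) \<longlonglongrightarrow> x\<^sup>2 * 0"
    by (intro tendsto_intros x_lim nK_lim)
  moreover have "\<forall>\<^sub>F n in sequentially. ((2 * real (j n) - real (K n)) / sqrt (real n))\<^sup>2 * (real n / real (K n))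
      = (2 * real (j n) - real (K n))\<^sup>2 / real (K n)"
    using eventually_gt_at_top[of 0] by eventually_elim (simp add: power_divide)
  ultimately show "(\<lambda>n. (2 * real (j n) - real (K n))\<^sup>2 / real (K n)) \<longlonglongrightarrow> 0"
    using Lim_transform_eventually by fastforce
qed

lemma sum_scaled_binomial_eq:
  "2 / sqrt n * (\<Sum>j\<le>K. scaled_binomial K j * F j)
    = sqrt (2 * pi * (real K / n)) * (\<Sum>j\<le>K. real (K choose j) / 2 ^ K * F j)"
proof -
  have "2 * sqrt (pi * real K / 2) = sqrt (2 * pi * real K)"
    using real_sqrt_mult[of 4 "pi * real K / 2"] by (simp add: mult.assoc)
  then have "2 / sqrt n * sqrt (pi * real K / 2) = sqrt (2 * pi * real K) / sqrt n"
    by (simp only: times_divide_eq_left)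
  also have "\<dots> = sqrt (2 * pi * (real K / n))" by (simp flip: real_sqrt_divide)
  finally show ?thesis
    by (simp only: scaled_binomial_def sum_distrib_left mult.assoc[symmetric])
qed

lemma scaled_binomial_bounded:
  obtains c where "\<And>K j. scaled_binomial K j \<le> c"
proof -
  have "Bseq (\<lambda>K. scaled_binomial K (K div 2))"
    by (rule convergent_imp_Bseq[OF convergentI[OF scaled_binomial_half_tendsto]])
  then obtain c where half_le: "\<And>K. \<bar>scaled_binomial K (K div 2)\<bar> \<le> c" by (metis BseqE real_norm_def)
  have "scaled_binomial K j \<le> c" for K j
    using scaled_binomial_le_half half_le[of K] by (rule order_trans[OF _ abs_le_D1])
  then show thesis by (rule that)
qed

subsection \<open>Sums over a lattice as Riemann sums\<close>

lemma integral_dominated_convergence_eventually: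
  fixes f :: "'a \<Rightarrow> 'b::{banach, second_countable_topology}" and s :: "nat \<Rightarrow> 'a \<Rightarrow> 'b" and w :: "'a \<Rightarrow> real"
  assumes "f \<in> borel_measurable M" "\<And>n. s n \<in> borel_measurable M" "integrable M w"
    and lim: "AE x in M. (\<lambda>n. s n x) \<longlonglongrightarrow> f x"
    and bound: "\<forall>\<^sub>F n in sequentially. AE x in M. norm (s n x) \<le> w x"
  shows "(\<lambda>n. integral\<^sup>L M (s n)) \<longlonglongrightarrow> integral\<^sup>L M f"
proof -
  obtain n0 where bound_from: "\<And>n. n \<ge> n0 \<Longrightarrow> AE x in M. norm (s n x) \<le> w x"
    using bound by (auto simp: eventually_sequentially)
  show ?thesis
  proof (rule LIMSEQ_offset, rule integral_dominated_convergence)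
    show "AE x in M. norm (s (n + n0) x) \<le> w x" for n by (rule bound_from) simp
    show "AE x in M. (\<lambda>n. s (n + n0) x) \<longlonglongrightarrow> f x"
      using lim by eventually_elim (rule LIMSEQ_ignore_initial_segment)
  qed (use assms in auto)
qed

definition lattice_cell :: "nat \<Rightarrow> real \<Rightarrow> nat \<Rightarrow> real set" where
  "lattice_cell K s j = {(2 * real j - real K) / s ..< (2 * real j + 2 - real K) / s}"

definition lattice_step :: "nat \<Rightarrow> real \<Rightarrow> (nat \<Rightarrow> real) \<Rightarrow> real \<Rightarrow> real" where
  "lattice_step K s c x = (\<Sum>j\<le>K. c j * indicator (lattice_cell K s j) x)"

lemma lattice_cell_iff_floor:
  assumes "s > 0"
  shows "x \<in> lattice_cell K s j \<longleftrightarrow> \<lfloor>(x * s + real K) / 2\<rfloor> = int j"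
proof -
  have "x \<in> lattice_cell K s j \<longleftrightarrow> real_of_int (int j) \<le> (x * s + real K) / 2
      \<and> (x * s + real K) / 2 < real_of_int (int j) + 1"
    using assms by (auto simp: lattice_cell_def field_simps)
  then show ?thesis by (metis floor_eq_iff)
qed

lemma lattice_cell_dist:
  assumes "s > 0" "x \<in> lattice_cell K s j"
  shows "\<bar>(2 * real j - real K) / s - x\<bar> \<le> 2 / s"
  using assms by (auto simp: lattice_cell_def add_divide_distrib diff_divide_distrib abs_le_iff)

lemma lattice_step_eq:
  assumes "s > 0" "x \<in> lattice_cell K s j" "j \<le> K"
  shows "lattice_step K s c x = c j"
proof -
  have "lattice_step K s c x = (\<Sum>i\<le>K. if i = j then c j else 0)"
    using assms lattice_cell_iff_floor[OF assms(1), of x K]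
    unfolding lattice_step_def by (intro sum.cong) (auto simp: indicator_def)
  then show ?thesis using assms(3) by simp
qed

lemma lattice_step_cases:
  assumes "s > 0"
  obtains j where "j \<le> K" "x \<in> lattice_cell K s j" "lattice_step K s c x = c j"
  | "lattice_step K s c x = 0"
proof (cases "\<exists>j\<le>K. x \<in> lattice_cell K s j")
  case True
  then show thesis using lattice_step_eq[OF assms] that(1) by blast
next
  case False
  then have "lattice_step K s c x = 0"
    by (auto simp: lattice_step_def indicator_def intro!: sum.neutral)
  then show thesis by (rule that(2))
qed

lemma has_bochner_integral_lattice_step:
  assumes "s > 0"
  shows "has_bochner_integral lborel (lattice_step K s c) (2 / s * (\<Sum>j\<le>K. c j))"
proof -
  have "measure lborel (lattice_cell K s j) = 2 / s" for j
    using assms by (simp add: lattice_cell_def divide_right_mono field_simps flip: diff_divide_distrib)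
  moreover have "emeasure lborel (lattice_cell K s j) < \<infinity>" for j
    using assms by (simp add: lattice_cell_def divide_right_mono)
  ultimately have "has_bochner_integral lborel (\<lambda>x. c j * indicator (lattice_cell K s j) x) (c j * (2 / s))" for j
    using has_bochner_integral_real_indicator[of "lattice_cell K s j" lborel]
    by (intro has_bochner_integral_mult_right) (auto simp: lattice_cell_def)
  then have "has_bochner_integral lborel (lattice_step K s c) (\<Sum>j\<le>K. c j * (2 / s))"
    unfolding lattice_step_def[abs_def] by (intro has_bochner_integral_sum)
  then show ?thesis by (simp only: sum_distrib_right[symmetric] mult.commute[of "2 / s"])
qed

lemma lattice_step_bound:
  assumes "s \<ge> 1" and A_nonneg: "A \<ge> 0"
    and c_bound: "\<And>j. j \<le> K \<Longrightarrow> \<bar>c j\<bar> \<le> A * inverse (1 + ((2 * real j - real K) / s)\<^sup>2)"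
  shows "\<bar>lattice_step K s c x\<bar> \<le> 9 * A * inverse (1 + x\<^sup>2)"
proof (rule lattice_step_cases[of s K x c])
  fix j assume j_cell: "j \<le> K" "x \<in> lattice_cell K s j" and step_eq: "lattice_step K s c x = c j"
  define y where "y = (2 * real j - real K) / s"
  have "\<bar>y - x\<bar> \<le> 2 / s" unfolding y_def using j_cell(2) assms(1) by (intro lattice_cell_dist) auto
  also have "\<dots> \<le> 2" using assms(1) by (simp add: divide_le_eq)
  finally have "\<bar>x\<bar>\<^sup>2 \<le> (\<bar>y\<bar> + 2)\<^sup>2" by (intro power_mono) auto
  also have "\<dots> \<le> 2 * y\<^sup>2 + 8"
    using zero_le_power2[of "\<bar>y\<bar> - 2"] by (simp add: power2_eq_square algebra_simps)
  also have "\<dots> \<le> 9 * y\<^sup>2 + 8" by simp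
  finally have "1 + x\<^sup>2 \<le> 9 * (1 + y\<^sup>2)" by simp
  then have inverse_le: "inverse (9 * (1 + y\<^sup>2)) \<le> inverse (1 + x\<^sup>2)"
    by (intro le_imp_inverse_le) (auto simp: add_pos_nonneg)
  have "\<bar>c j\<bar> \<le> A * inverse (1 + y\<^sup>2)" using c_bound[OF j_cell(1)] by (simp add: y_def)
  also have "\<dots> = 9 * A * inverse (9 * (1 + y\<^sup>2))" by (simp only: inverse_mult_distrib) simp
  also have "\<dots> \<le> 9 * A * inverse (1 + x\<^sup>2)" using A_nonneg by (intro mult_left_mono inverse_le) auto
  finally show ?thesis unfolding step_eq .
next
  assume "lattice_step K s c x = 0"
  then show ?thesis using A_nonneg by simp
qed (use assms in simp)

lemma eventually_lattice_cell:
  assumes s_lim: "filterlim s at_top F"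
    and K_dominates: "((\<lambda>n. s n / real (K n)) \<longlongrightarrow> 0) F" "\<And>n. K n \<ge> 1"
  obtains j where "\<forall>\<^sub>F n in F. s n > 0 \<and> j n \<le> K n \<and> x \<in> lattice_cell (K n) (s n) (j n)"
proof
  have "((\<lambda>n. \<bar>x\<bar> * (s n / real (K n))) \<longlongrightarrow> \<bar>x\<bar> * 0) F" by (intro tendsto_intros K_dominates)
  then have "\<forall>\<^sub>F n in F. \<bar>x\<bar> * (s n / real (K n)) < 1" by (rule order_tendstoD) simp
  moreover have "\<forall>\<^sub>F n in F. s n > 0" using s_lim by (simp add: filterlim_at_top_dense)
  ultimately show "\<forall>\<^sub>F n in F. s n > 0 \<and> nat \<lfloor>(x * s n + real (K n)) / 2\<rfloor> \<le> K n
      \<and> x \<in> lattice_cell (K n) (s n) (nat \<lfloor>(x * s n + real (K n)) / 2\<rfloor>)"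
  proof eventually_elim
    case (elim n)
    define u where "u = x * s n + real (K n)"
    have "\<bar>x * s n\<bar> \<le> real (K n)"
      using elim K_dominates(2)[of n] by (simp add: abs_mult field_simps)
    then have "0 \<le> u" "u \<le> 2 * real (K n)" by (auto simp: u_def)
    then have "0 \<le> \<lfloor>u / 2\<rfloor>" "\<lfloor>u / 2\<rfloor> \<le> int (K n)" by linarith+
    then show ?case using elim by (simp add: lattice_cell_iff_floor nat_le_iff flip: u_def)
  qed
qed

lemma lattice_step_tendsto:
  fixes c :: "nat \<Rightarrow> nat \<Rightarrow> real"
  assumes s_lim: "filterlim s at_top sequentially"
    and K_dominates: "(\<lambda>n. s n / real (K n)) \<longlonglongrightarrow> 0" "\<And>n. K n \<ge> 1"
    and c_lim: "\<And>j. \<forall>\<^sub>F n in sequentially. j n \<le> K n \<Longrightarrow> (\<lambda>n. (2 * real (j n) - real (K n)) / s n) \<longlonglongrightarrow> x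
      \<Longrightarrow> (\<lambda>n. c n (j n)) \<longlonglongrightarrow> h"
  shows "(\<lambda>n. lattice_step (K n) (s n) (c n) x) \<longlonglongrightarrow> h"
proof -
  obtain j where j_cell: "\<forall>\<^sub>F n in sequentially. s n > 0 \<and> j n \<le> K n \<and> x \<in> lattice_cell (K n) (s n) (j n)"
    using eventually_lattice_cell[OF s_lim K_dominates] .
  have "(\<lambda>n. (2 * real (j n) - real (K n)) / s n) \<longlonglongrightarrow> x"
  proof (rule Lim_null_comparison[of _ "\<lambda>n. 2 / s n", THEN LIM_zero_cancel])
    show "(\<lambda>n. 2 / s n) \<longlonglongrightarrow> 0"
      by (rule tendsto_divide_0[OF tendsto_const filterlim_at_top_imp_at_infinity[OF s_lim]])
    show "\<forall>\<^sub>F n in sequentially. norm ((2 * real (j n) - real (K n)) / s n - x) \<le> 2 / s n"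
      using j_cell by eventually_elim (simp add: lattice_cell_dist)
  qed
  then have "(\<lambda>n. c n (j n)) \<longlonglongrightarrow> h"
    using j_cell by (intro c_lim) (auto elim: eventually_mono)
  then show ?thesis
  proof (rule Lim_transform_eventually)
    show "\<forall>\<^sub>F n in sequentially. c n (j n) = lattice_step (K n) (s n) (c n) x"
      using j_cell by eventually_elim (auto intro: lattice_step_eq[symmetric])
  qed
qed

lemma lattice_sum_tendsto_integral:
  fixes c :: "nat \<Rightarrow> nat \<Rightarrow> real"
  assumes s_lim: "filterlim s at_top sequentially"
    and K_dominates: "(\<lambda>n. s n / real (K n)) \<longlonglongrightarrow> 0" "\<And>n. K n \<ge> 1"
    and A_nonneg: "A \<ge> 0"
    and c_bound: "\<forall>\<^sub>F n in sequentially. \<forall>j\<le>K n. \<bar>c n j\<bar> \<le> A * inverse (1 + ((2 * real j - real (K n)) / s n)\<^sup>2)"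
    and c_lim: "\<And>x j. \<forall>\<^sub>F n in sequentially. j n \<le> K n \<Longrightarrow> (\<lambda>n. (2 * real (j n) - real (K n)) / s n) \<longlonglongrightarrow> x
      \<Longrightarrow> (\<lambda>n. c n (j n)) \<longlonglongrightarrow> h x"
  shows "(\<lambda>n. 2 / s n * (\<Sum>j\<le>K n. c n j)) \<longlonglongrightarrow> (LINT x|lborel. h x)"
proof -
  let ?G = "\<lambda>n. lattice_step (K n) (s n) (c n)"
  have step_measurable: "?G n \<in> borel_measurable borel" for n
    unfolding lattice_step_def[abs_def] lattice_cell_def by measurable
  have pointwise: "(\<lambda>n. ?G n x) \<longlonglongrightarrow> h x" for x
    by (rule lattice_step_tendsto[OF s_lim K_dominates c_lim])
  have "(\<lambda>n. LINT x|lborel. ?G n x) \<longlonglongrightarrow> (LINT x|lborel. h x)"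
  proof (rule integral_dominated_convergence_eventually)
    show "h \<in> borel_measurable lborel"
      by (rule borel_measurable_LIMSEQ_real[of _ ?G]) (simp_all add: pointwise step_measurable)
    show "integrable lborel (\<lambda>x. 9 * A * inverse (1 + x\<^sup>2))"
      using integrable_inverse_1_plus_square by (intro integrable_mult_right) (simp add: set_integrable_def)
    have "\<forall>\<^sub>F n in sequentially. s n \<ge> 1" using s_lim by (simp add: filterlim_at_top)
    with c_bound show "\<forall>\<^sub>F n in sequentially. AE x in lborel. norm (?G n x) \<le> 9 * A * inverse (1 + x\<^sup>2)"
      by eventually_elim (auto intro!: AE_I2 lattice_step_bound A_nonneg)
  qed (auto simp: pointwise step_measurable)
  moreover have "\<forall>\<^sub>F n in sequentially. s n > 0" using s_lim by (simp add: filterlim_at_top_dense)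
  then have "\<forall>\<^sub>F n in sequentially. (LINT x|lborel. ?G n x) = 2 / s n * (\<Sum>j\<le>K n. c n j)"
    by eventually_elim (intro has_bochner_integral_integral_eq has_bochner_integral_lattice_step)
  ultimately show ?thesis by (rule Lim_transform_eventually)
qed

lemma binomial_sum_tendsto_integral:
  fixes F :: "nat \<Rightarrow> nat \<Rightarrow> real" and K :: "nat \<Rightarrow> nat"
  assumes K_lim: "filterlim K at_top sequentially" and K_pos: "\<And>n. K n \<ge> 1"
    and nK_lim: "(\<lambda>n. real n / real (K n)) \<longlonglongrightarrow> 0"
    and A_nonneg: "A \<ge> 0"
    and F_bound: "\<forall>\<^sub>F n in sequentially. \<forall>j\<le>K n. \<bar>F n j\<bar> \<le> A * inverse (1 + ((2 * real j - real (K n)) / sqrt (real n))\<^sup>2)"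
    and F_lim: "\<And>x j. \<forall>\<^sub>F n in sequentially. j n \<le> K n \<Longrightarrow>
      (\<lambda>n. (2 * real (j n) - real (K n)) / sqrt (real n)) \<longlonglongrightarrow> x \<Longrightarrow> (\<lambda>n. F n (j n)) \<longlonglongrightarrow> h x"
  shows "(\<lambda>n. sqrt (2 * pi * (real (K n) / real n)) * (\<Sum>j\<le>K n. real (K n choose j) / 2 ^ K n * F n j))
    \<longlonglongrightarrow> (LINT x|lborel. h x)"
proof -
  obtain C where scaled_le_C: "\<And>K j. scaled_binomial K j \<le> C" using scaled_binomial_bounded by blast
  show ?thesis
    unfolding sum_scaled_binomial_eq[symmetric]
  proof (rule lattice_sum_tendsto_integral[OF _ _ K_pos])
    show "C * A \<ge> 0" using A_nonneg order_trans[OF scaled_binomial_nonneg scaled_le_C] by simp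
    show "filterlim (\<lambda>n. sqrt (real n)) at_top sequentially" by real_asymp
    show "(\<lambda>n. sqrt (real n) / real (K n)) \<longlonglongrightarrow> 0"
    proof (rule Lim_null_comparison[OF always_eventually nK_lim], rule allI)
      fix n
      have "sqrt (real n) \<le> real n" by (cases "n = 0") (auto intro: real_le_lsqrt simp: power2_eq_square)
      then show "norm (sqrt (real n) / real (K n)) \<le> real n / real (K n)" by (simp add: divide_right_mono)
    qed
    show "\<forall>\<^sub>F n in sequentially. \<forall>j\<le>K n. \<bar>scaled_binomial (K n) j * F n j\<bar>
        \<le> C * A * inverse (1 + ((2 * real j - real (K n)) / sqrt (real n))\<^sup>2)"
      using F_bound
    proof eventually_elim
      case (elim n)
      then show ?case
        using scaled_le_C scaled_binomial_nonneg order_trans[OF scaled_binomial_nonneg scaled_le_C]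
        by (auto simp: abs_mult mult.assoc intro!: mult_mono)
    qed
    show "(\<lambda>n. scaled_binomial (K n) (j n) * F n (j n)) \<longlonglongrightarrow> h x"
      if "\<forall>\<^sub>F n in sequentially. j n \<le> K n" "(\<lambda>n. (2 * real (j n) - real (K n)) / sqrt (real n)) \<longlonglongrightarrow> x" for x j
      using tendsto_mult[OF scaled_binomial_rescaled_tendsto[OF K_lim that(1) nK_lim that(2)] F_lim[OF that]] by simp
  qed
qed

subsection \<open>Second differences along a direction\<close>

definition second_difference :: "('a::real_vector \<Rightarrow> real) \<Rightarrow> 'a \<Rightarrow> 'a \<Rightarrow> real \<Rightarrow> real" where
  "second_difference g e a r = g (a + r *\<^sub>R e) + g (a - r *\<^sub>R e) - 2 * g a"

text \<open>Second differences are quadratic up to a cubic error. Comparing two step sizes avoids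
  derivatives, so that the condition passes to averages of translates of \<open>g\<close>.\<close>

definition lindeberg_regular :: "real \<Rightarrow> 'a::real_vector \<Rightarrow> ('a \<Rightarrow> real) \<Rightarrow> bool" where
  "lindeberg_regular L e g \<longleftrightarrow>
     (\<forall>a r. \<bar>g (a + r *\<^sub>R e) - g a\<bar> \<le> L * \<bar>r\<bar>) \<and>
     (\<forall>a r s. \<bar>r\<^sup>2 * second_difference g e a s - s\<^sup>2 * second_difference g e a r\<bar>
        \<le> L * (r\<^sup>2 * s\<^sup>2 * (\<bar>r\<bar> + \<bar>s\<bar>)))"

lemma lindeberg_regular_lipschitz:
  "lindeberg_regular L e g \<Longrightarrow> \<bar>g (a + r *\<^sub>R e) - g a\<bar> \<le> L * \<bar>r\<bar>"
  by (simp add: lindeberg_regular_def)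

lemma lindeberg_regular_second_difference:
  "lindeberg_regular L e g \<Longrightarrow>
    \<bar>r\<^sup>2 * second_difference g e a s - s\<^sup>2 * second_difference g e a r\<bar> \<le> L * (r\<^sup>2 * s\<^sup>2 * (\<bar>r\<bar> + \<bar>s\<bar>))"
  unfolding lindeberg_regular_def by blast

lemma lindeberg_regular_nonneg:
  assumes "lindeberg_regular L e g"
  shows "L \<ge> 0"
  using order_trans[OF abs_ge_zero lindeberg_regular_lipschitz[OF assms, of 0 1]] by simp

lemma lindeberg_regular_mono:
  assumes "lindeberg_regular L e g" "L \<le> L'"
  shows "lindeberg_regular L' e g"
proof -
  have "L * x \<le> L' * x" if "x \<ge> 0" for x using assms(2) that by (rule mult_right_mono)
  then show ?thesis
    using assms(1) unfolding lindeberg_regular_def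
    by (meson abs_ge_zero add_nonneg_nonneg mult_nonneg_nonneg order_trans zero_le_power2)
qed

primrec dir_deriv :: "'a::euclidean_space \<Rightarrow> nat \<Rightarrow> ('a \<Rightarrow> real) \<Rightarrow> 'a \<Rightarrow> real" where
  "dir_deriv e 0 f = f"
| "dir_deriv e (Suc m) f = (\<lambda>x. frechet_derivative (dir_deriv e m f) (at x) e)"

lemma C_k_dir_deriv: "(\<And>k. C_k k f) \<Longrightarrow> C_k k (dir_deriv e m f)"
proof (induction m arbitrary: k)
  case (Suc m)
  from Suc.IH[OF Suc.prems, of "Suc k"] show ?case by simp
qed simp

lemma dir_deriv_has_derivative:
  assumes "\<And>k. C_k k f"
  shows "((\<lambda>s. dir_deriv e m f (a + s *\<^sub>R e)) has_real_derivative dir_deriv e (Suc m) f (a + s *\<^sub>R e)) (at s)"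
proof -
  let ?g = "dir_deriv e m f" and ?D = "frechet_derivative (dir_deriv e m f) (at (a + s *\<^sub>R e))"
  have "?g differentiable at (a + s *\<^sub>R e)"
    using C_k_dir_deriv[OF assms, of "Suc 0" e m] by simp
  then have derivative: "(?g has_derivative ?D) (at (a + s *\<^sub>R e))"
    by (simp add: frechet_derivative_works)
  have "((\<lambda>s. a + s *\<^sub>R e) has_derivative (\<lambda>h. h *\<^sub>R e)) (at s)"
    by (auto intro!: derivative_eq_intros)
  from has_derivative_compose[OF this derivative]
  have "((\<lambda>s. ?g (a + s *\<^sub>R e)) has_derivative (\<lambda>h. ?D (h *\<^sub>R e))) (at s)" .
  moreover have "?D (h *\<^sub>R e) = ?D e * h" for h
    using linear_cmul[OF has_derivative_linear[OF derivative]] by simp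
  ultimately show ?thesis by (simp add: has_field_derivative_def)
qed

lemma dir_deriv_taylor:
  assumes "\<And>k. C_k k f"
  obtains s where "f (a + r *\<^sub>R e)
    = (\<Sum>m<n. dir_deriv e m f a / fact m * r ^ m) + dir_deriv e n f (a + s *\<^sub>R e) / fact n * r ^ n"
proof -
  have "\<forall>m x. DERIV (\<lambda>s. dir_deriv e m f (a + s *\<^sub>R e)) x :> dir_deriv e (Suc m) f (a + x *\<^sub>R e)"
    using dir_deriv_has_derivative[OF assms] by blast
  from Maclaurin_all_le[where diff = "\<lambda>m s. dir_deriv e m f (a + s *\<^sub>R e)" and x = r and n = n
      and f = "\<lambda>s. f (a + s *\<^sub>R e)", OF _ this]
  show thesis using that by auto
qed

lemma dir_deriv_eq_0:
  assumes "\<And>k. C_k k f" "x \<notin> closure {x. f x \<noteq> 0}"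
  shows "dir_deriv e m f x = 0"
  using assms(2)
proof (induction m arbitrary: x)
  case 0
  then show ?case using closure_subset by force
next
  case (Suc m)
  let ?g = "dir_deriv e m f" and ?S = "- closure {x. f x \<noteq> 0}"
  have "((\<lambda>_. 0) has_derivative (\<lambda>_. 0)) (at x)" by simp
  then have "(?g has_derivative (\<lambda>_. 0)) (at x)"
    by (rule has_derivative_transform_within_open[where s = ?S]) (use Suc in auto)
  then have "frechet_derivative ?g (at x) = (\<lambda>_. 0)"
    by (metis frechet_derivative_at)
  then show ?case by simp
qed

lemma dir_deriv_bounded:
  assumes "smooth_compact_support f"
  obtains B where "\<And>x. \<bar>dir_deriv e m f x\<bar> \<le> B"
proof -
  let ?g = "dir_deriv e m f" and ?S = "closure {x. f x \<noteq> 0}"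
  have smooth: "C_k k f" for k using assms by (simp add: smooth_compact_support_def)
  have "continuous_on UNIV ?g" using C_k_dir_deriv[OF smooth, where k = 0] by simp
  then have "compact (?g ` ?S)"
    using assms by (intro compact_continuous_image)
      (auto simp: smooth_compact_support_def intro: continuous_on_subset)
  then obtain B where bounded_on_support: "\<And>x. x \<in> ?S \<Longrightarrow> \<bar>?g x\<bar> \<le> B"
    by (fastforce dest!: compact_imp_bounded simp: bounded_iff)
  have "\<bar>?g x\<bar> \<le> max B 0" for x
    using bounded_on_support[of x] dir_deriv_eq_0[OF smooth, of x e m] by (cases "x \<in> ?S") auto
  then show thesis by (rule that)
qed

lemma smooth_compact_support_continuous:
  "smooth_compact_support f \<Longrightarrow> continuous_on UNIV f"
  unfolding smooth_compact_support_def by (metis C_k.simps(1))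

lemma smooth_compact_support_bounded_support:
  assumes "smooth_compact_support f"
  obtains R where "\<And>x. f x \<noteq> 0 \<Longrightarrow> norm x \<le> R"
proof -
  obtain R where norm_le_R: "\<And>x. x \<in> closure {x. f x \<noteq> 0} \<Longrightarrow> norm x \<le> R"
    using assms unfolding smooth_compact_support_def by (metis compact_imp_bounded bounded_iff)
  have "f x \<noteq> 0 \<Longrightarrow> norm x \<le> R" for x
    using norm_le_R closure_subset[of "{x. f x \<noteq> 0}"] by auto
  then show thesis by (rule that)
qed

lemma dir_deriv_lipschitz:
  assumes smooth: "\<And>k. C_k k f" and bounded: "\<And>x. \<bar>dir_deriv e 1 f x\<bar> \<le> B"
  shows "\<bar>f (a + r *\<^sub>R e) - f a\<bar> \<le> B * \<bar>r\<bar>"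
proof -
  obtain s where "f (a + r *\<^sub>R e)
      = (\<Sum>m<1. dir_deriv e m f a / fact m * r ^ m) + dir_deriv e 1 f (a + s *\<^sub>R e) / fact 1 * r ^ 1"
    using dir_deriv_taylor[OF smooth] .
  then show ?thesis using bounded[of "a + s *\<^sub>R e"] by (simp add: abs_mult mult_right_mono)
qed

lemma second_difference_taylor:
  assumes smooth: "\<And>k. C_k k f" and bounded: "\<And>x. \<bar>dir_deriv e 3 f x\<bar> \<le> B"
  shows "\<bar>second_difference f e a u - dir_deriv e 2 f a * u\<^sup>2\<bar> \<le> B / 3 * \<bar>u\<bar> ^ 3"
proof -
  define d q where "d = dir_deriv e 1 f a" and "q = dir_deriv e 2 f a"
  have one_sided: "\<bar>f (a + u *\<^sub>R e) - f a - d * u - q / 2 * u\<^sup>2\<bar> \<le> B / 6 * \<bar>u\<bar> ^ 3" for u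
  proof -
    obtain s where "f (a + u *\<^sub>R e)
        = (\<Sum>m<3. dir_deriv e m f a / fact m * u ^ m) + dir_deriv e 3 f (a + s *\<^sub>R e) / fact 3 * u ^ 3"
      using dir_deriv_taylor[OF smooth] .
    then have remainder: "f (a + u *\<^sub>R e) - f a - d * u - q / 2 * u\<^sup>2 = dir_deriv e 3 f (a + s *\<^sub>R e) / 6 * u ^ 3"
      by (simp add: d_def q_def eval_nat_numeral)
    show ?thesis
      unfolding remainder using bounded[of "a + s *\<^sub>R e"] by (simp add: abs_mult power_abs mult_right_mono)
  qed
  have "\<bar>f (a - u *\<^sub>R e) - f a + d * u - q / 2 * u\<^sup>2\<bar> \<le> B / 6 * \<bar>u\<bar> ^ 3"
    using one_sided[of "- u"] by simp
  with one_sided[of u] show ?thesis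
    unfolding second_difference_def q_def[symmetric] by linarith
qed

lemma second_difference_compare:
  assumes smooth: "\<And>k. C_k k f" and bounded: "\<And>x. \<bar>dir_deriv e 3 f x\<bar> \<le> B"
  shows "\<bar>r\<^sup>2 * second_difference f e a s - s\<^sup>2 * second_difference f e a r\<bar>
    \<le> B / 3 * (r\<^sup>2 * s\<^sup>2 * (\<bar>r\<bar> + \<bar>s\<bar>))"
proof -
  let ?\<epsilon> = "\<lambda>u. second_difference f e a u - dir_deriv e 2 f a * u\<^sup>2"
  have "r\<^sup>2 * second_difference f e a s - s\<^sup>2 * second_difference f e a r = r\<^sup>2 * ?\<epsilon> s - s\<^sup>2 * ?\<epsilon> r"
    by (simp add: algebra_simps)
  also have "\<bar>\<dots>\<bar> \<le> r\<^sup>2 * \<bar>?\<epsilon> s\<bar> + s\<^sup>2 * \<bar>?\<epsilon> r\<bar>"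
    by (rule order_trans[OF abs_triangle_ineq4]) (simp add: abs_mult)
  also have "\<dots> \<le> r\<^sup>2 * (B / 3 * \<bar>s\<bar> ^ 3) + s\<^sup>2 * (B / 3 * \<bar>r\<bar> ^ 3)"
    by (intro add_mono mult_left_mono second_difference_taylor[OF smooth bounded]) auto
  also have "\<dots> = B / 3 * (r\<^sup>2 * s\<^sup>2 * (\<bar>r\<bar> + \<bar>s\<bar>))"
    unfolding power2_abs[of r, symmetric] power2_abs[of s, symmetric]
    by (simp add: power2_eq_square power3_eq_cube algebra_simps del: abs_mult_self_eq)
  finally show ?thesis .
qed

lemma smooth_compact_support_imp_lindeberg_regular:
  assumes "smooth_compact_support f"
  obtains L where "lindeberg_regular L e f"
proof -
  have smooth: "C_k k f" for k using assms by (simp add: smooth_compact_support_def)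
  obtain B\<^sub>1 where first_bounded: "\<And>x. \<bar>dir_deriv e 1 f x\<bar> \<le> B\<^sub>1" using dir_deriv_bounded[OF assms, of e 1] by blast
  obtain B\<^sub>3 where third_bounded: "\<And>x. \<bar>dir_deriv e 3 f x\<bar> \<le> B\<^sub>3" using dir_deriv_bounded[OF assms, of e 3] by blast
  have "lindeberg_regular (max B\<^sub>1 (B\<^sub>3 / 3)) e f"
    unfolding lindeberg_regular_def
  proof (intro conjI allI)
    fix a r s
    show "\<bar>f (a + r *\<^sub>R e) - f a\<bar> \<le> max B\<^sub>1 (B\<^sub>3 / 3) * \<bar>r\<bar>"
      by (rule order_trans[OF dir_deriv_lipschitz[OF smooth first_bounded] mult_right_mono]) auto
    show "\<bar>r\<^sup>2 * second_difference f e a s - s\<^sup>2 * second_difference f e a r\<bar>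
        \<le> max B\<^sub>1 (B\<^sub>3 / 3) * (r\<^sup>2 * s\<^sup>2 * (\<bar>r\<bar> + \<bar>s\<bar>))"
      by (rule order_trans[OF second_difference_compare[OF smooth third_bounded] mult_right_mono]) auto
  qed
  then show thesis by (rule that)
qed

lemma smooth_compact_support_lindeberg_regular_indicator:
  fixes \<phi> :: "real ^ 's \<Rightarrow> real"
  assumes "smooth_compact_support \<phi>"
  obtains L where "\<And>S. lindeberg_regular L (\<chi> i. of_bool (i \<in> S)) \<phi>"
proof -
  have "\<exists>L. lindeberg_regular L (\<chi> i. of_bool (i \<in> S)) \<phi>" for S :: "'s set"
    using smooth_compact_support_imp_lindeberg_regular[OF assms] by blast
  then obtain L where L_regular: "\<And>S :: 's set. lindeberg_regular (L S) (\<chi> i. of_bool (i \<in> S)) \<phi>"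
    by metis
  have "L S \<le> (\<Sum>S\<in>UNIV. L S)" for S
    by (rule member_le_sum) (auto intro: lindeberg_regular_nonneg[OF L_regular])
  then show thesis by (intro that lindeberg_regular_mono[OF L_regular])
qed

lemma abs_integral_le_integral:
  fixes f g :: "'a \<Rightarrow> real"
  assumes "integrable M f" "integrable M g" "\<And>x. x \<in> space M \<Longrightarrow> \<bar>f x\<bar> \<le> g x"
  shows "\<bar>\<integral>x. f x \<partial>M\<bar> \<le> (\<integral>x. g x \<partial>M)"
  using assms by (intro order_trans[OF integral_abs_bound integral_mono]) auto

lemma (in prob_space) abs_expectation_le:
  fixes f :: "'a \<Rightarrow> real"
  assumes bounded: "\<And>\<omega>. \<bar>f \<omega>\<bar> \<le> B"
  shows "\<bar>expectation f\<bar> \<le> B"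
proof (cases "integrable M f")
  case True
  then show ?thesis
    using abs_integral_le_integral[of M f "\<lambda>_. B"] bounded by (simp add: prob_space)
next
  case False
  then show ?thesis
    using order_trans[OF abs_ge_zero bounded] by (simp add: not_integrable_integral_eq)
qed

lemma (in prob_space) lindeberg_regular_expectation:
  fixes g :: "'b::euclidean_space \<Rightarrow> real"
  assumes regular: "lindeberg_regular L e g"
    and g: "g \<in> borel_measurable borel" "\<And>x. \<bar>g x\<bar> \<le> B"
    and S: "S \<in> borel_measurable M"
  shows "lindeberg_regular L e (\<lambda>a. expectation (\<lambda>\<omega>. g (a + S \<omega>)))"
proof -
  have int: "integrable M (\<lambda>\<omega>. g (a + S \<omega>))" for a
    using g S by (intro integrable_const_bound[of _ B]) auto
  have second_difference_eq: "second_difference g e (a + S \<omega>) r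
      = g (a + r *\<^sub>R e + S \<omega>) + g (a - r *\<^sub>R e + S \<omega>) - 2 * g (a + S \<omega>)" for a r \<omega>
    by (simp add: second_difference_def algebra_simps)
  have int_difference: "integrable M (\<lambda>\<omega>. second_difference g e (a + S \<omega>) r)" for a r
    unfolding second_difference_eq by (simp add: int)
  have commute: "second_difference (\<lambda>a. expectation (\<lambda>\<omega>. g (a + S \<omega>))) e a r
      = expectation (\<lambda>\<omega>. second_difference g e (a + S \<omega>) r)" for a r
    unfolding second_difference_eq by (simp add: second_difference_def int)
  show ?thesis
    unfolding lindeberg_regular_def
  proof (intro conjI allI)
    fix a r s
    have "\<bar>expectation (\<lambda>\<omega>. g (a + S \<omega> + r *\<^sub>R e) - g (a + S \<omega>))\<bar> \<le> L * \<bar>r\<bar>"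
      by (intro abs_expectation_le lindeberg_regular_lipschitz[OF regular])
    then show "\<bar>expectation (\<lambda>\<omega>. g (a + r *\<^sub>R e + S \<omega>)) - expectation (\<lambda>\<omega>. g (a + S \<omega>))\<bar> \<le> L * \<bar>r\<bar>"
      using int[of "a + r *\<^sub>R e"] int[of a] by (simp add: add_ac)
    have "\<bar>expectation (\<lambda>\<omega>. r\<^sup>2 * second_difference g e (a + S \<omega>) s - s\<^sup>2 * second_difference g e (a + S \<omega>) r)\<bar>
        \<le> L * (r\<^sup>2 * s\<^sup>2 * (\<bar>r\<bar> + \<bar>s\<bar>))"
      by (intro abs_expectation_le lindeberg_regular_second_difference[OF regular])
    then show "\<bar>r\<^sup>2 * second_difference (\<lambda>a. expectation (\<lambda>\<omega>. g (a + S \<omega>))) e a s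
        - s\<^sup>2 * second_difference (\<lambda>a. expectation (\<lambda>\<omega>. g (a + S \<omega>))) e a r\<bar> \<le> L * (r\<^sup>2 * s\<^sup>2 * (\<bar>r\<bar> + \<bar>s\<bar>))"
      by (simp add: commute int_difference)
  qed
qed

subsection \<open>Gaussian increments\<close>

lemma (in prob_space) normal_distributed_expectation_uminus:
  assumes normal: "distributed M lborel D (normal_density 0 \<sigma>)" "\<sigma> > 0"
    and f: "f \<in> borel_measurable borel"
  shows "expectation (\<lambda>\<omega>. f (- D \<omega>)) = expectation (\<lambda>\<omega>. f (D \<omega>) :: real)"
proof -
  have reflected: "distributed M lborel (\<lambda>\<omega>. - D \<omega>) (normal_density 0 \<sigma>)"
    using normal_density_affine[OF normal, of "- 1" 0] by simp
  show ?thesis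
    using distributed_integral[OF reflected, of f] distributed_integral[OF normal(1), of f] f by simp
qed

lemma (in prob_space) normal_distributed_even_moment:
  assumes normal: "distributed M lborel D (normal_density 0 \<sigma>)" "\<sigma> > 0"
  shows "has_bochner_integral M (\<lambda>\<omega>. D \<omega> ^ (2 * k)) (fact (2 * k) / ((2 / \<sigma>\<^sup>2) ^ k * fact k))"
proof -
  note moment = normal_moment_even[OF normal(2), of 0 k]
  have "expectation (\<lambda>\<omega>. D \<omega> ^ (2 * k)) = fact (2 * k) / ((2 / \<sigma>\<^sup>2) ^ k * fact k)"
    using distributed_integral[OF normal(1), of "\<lambda>x. x ^ (2 * k)"] has_bochner_integral_integral_eq[OF moment] by simp
  moreover have "integrable M (\<lambda>\<omega>. D \<omega> ^ (2 * k))"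
    using distributed_integrable[OF normal(1), of "\<lambda>x. x ^ (2 * k)"] integrable.intros[OF moment] by simp
  ultimately show ?thesis by (simp add: has_bochner_integral_iff)
qed

lemma (in prob_space) normal_distributed_second_difference:
  fixes h :: "'b::euclidean_space \<Rightarrow> real"
  assumes normal: "distributed M lborel D (normal_density 0 \<sigma>)" "\<sigma> > 0"
    and h: "h \<in> borel_measurable borel" "\<And>x. \<bar>h x\<bar> \<le> B"
  shows "has_bochner_integral M (\<lambda>\<omega>. second_difference h e a (D \<omega>))
    (2 * (expectation (\<lambda>\<omega>. h (a + D \<omega> *\<^sub>R e)) - h a))"
proof -
  have [measurable]: "D \<in> borel_measurable M" using distributed_measurable[OF normal(1)] by simp
  have "integrable M (\<lambda>\<omega>. h (a + D \<omega> *\<^sub>R e))" "integrable M (\<lambda>\<omega>. h (a - D \<omega> *\<^sub>R e))"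
    using h by (auto intro!: integrable_const_bound[of _ B])
  moreover have "expectation (\<lambda>\<omega>. h (a - D \<omega> *\<^sub>R e)) = expectation (\<lambda>\<omega>. h (a + D \<omega> *\<^sub>R e))"
    using normal_distributed_expectation_uminus[OF normal, of "\<lambda>x. h (a + x *\<^sub>R e)"] h(1) by simp
  ultimately show ?thesis
    unfolding second_difference_def by (simp add: has_bochner_integral_iff prob_space)
qed

lemma abs_cube_le:
  fixes x \<sigma> :: real
  assumes "\<sigma> > 0"
  shows "x\<^sup>2 * \<bar>x\<bar> \<le> \<sigma> / 2 * x\<^sup>2 + 1 / (2 * \<sigma>) * x ^ 4"
proof -
  have "0 \<le> x\<^sup>2 * (\<sigma> - \<bar>x\<bar>)\<^sup>2 / (2 * \<sigma>)" using assms by simp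
  also have "\<dots> = \<sigma> / 2 * x\<^sup>2 + 1 / (2 * \<sigma>) * x ^ 4 - x\<^sup>2 * \<bar>x\<bar>"
    using assms by (simp add: power2_eq_square power4_eq_xxxx field_simps)
  finally show ?thesis by simp
qed

lemma lindeberg_regular_second_difference_quartic:
  assumes regular: "lindeberg_regular L e h" and "\<sigma> > 0"
  shows "\<bar>\<sigma>\<^sup>2 * second_difference h e a x - x\<^sup>2 * second_difference h e a \<sigma>\<bar>
    \<le> L * \<sigma>\<^sup>2 * (3 / 2 * \<sigma> * x\<^sup>2 + 1 / (2 * \<sigma>) * x ^ 4)"
proof -
  have "\<bar>\<sigma>\<^sup>2 * second_difference h e a x - x\<^sup>2 * second_difference h e a \<sigma>\<bar> \<le> L * (\<sigma>\<^sup>2 * x\<^sup>2 * (\<sigma> + \<bar>x\<bar>))"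
    using lindeberg_regular_second_difference[OF regular, of \<sigma> a x] assms(2) by simp
  also have "\<dots> = L * \<sigma>\<^sup>2 * (\<sigma> * x\<^sup>2 + x\<^sup>2 * \<bar>x\<bar>)" by (simp add: algebra_simps)
  also have "\<dots> \<le> L * \<sigma>\<^sup>2 * (\<sigma> * x\<^sup>2 + (\<sigma> / 2 * x\<^sup>2 + 1 / (2 * \<sigma>) * x ^ 4))"
    using lindeberg_regular_nonneg[OF regular] assms(2) by (intro mult_left_mono add_left_mono abs_cube_le) auto
  finally show ?thesis by (simp add: algebra_simps)
qed

text \<open>The Gaussian and the symmetric two-point law with the same variance agree up to second
  moments, so that only the cubic error of the second difference contributes.\<close>

lemma (in prob_space) gaussian_two_point_diff:
  fixes h :: "'b::euclidean_space \<Rightarrow> real"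
  assumes normal: "distributed M lborel D (normal_density 0 \<sigma>)" "\<sigma> > 0"
    and regular: "lindeberg_regular L e h" and h: "h \<in> borel_measurable borel" "\<And>x. \<bar>h x\<bar> \<le> B"
  shows "\<bar>expectation (\<lambda>\<omega>. h (a + D \<omega> *\<^sub>R e)) - (h (a + \<sigma> *\<^sub>R e) + h (a - \<sigma> *\<^sub>R e)) / 2\<bar> \<le> 3 / 2 * L * \<sigma> ^ 3"
proof -
  let ?\<Delta> = "second_difference h e a"
  define E where "E = expectation (\<lambda>\<omega>. h (a + D \<omega> *\<^sub>R e))"
  have variance: "has_bochner_integral M (\<lambda>\<omega>. (D \<omega>)\<^sup>2) (\<sigma>\<^sup>2)"
    using normal_distributed_even_moment[OF normal, of 1] by simp
  have kurtosis: "has_bochner_integral M (\<lambda>\<omega>. D \<omega> ^ 4) (3 * \<sigma> ^ 4)"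
    using normal_distributed_even_moment[OF normal, of 2] by (simp add: fact_numeral power_divide)
  have gap: "has_bochner_integral M (\<lambda>\<omega>. \<sigma>\<^sup>2 * ?\<Delta> (D \<omega>) - (D \<omega>)\<^sup>2 * ?\<Delta> \<sigma>)
      (\<sigma>\<^sup>2 * (2 * (E - h a)) - \<sigma>\<^sup>2 * ?\<Delta> \<sigma>)"
    unfolding E_def
    by (intro has_bochner_integral_diff has_bochner_integral_mult_right has_bochner_integral_mult_left
        normal_distributed_second_difference[OF normal h] variance)
  have dominating: "has_bochner_integral M
      (\<lambda>\<omega>. L * \<sigma>\<^sup>2 * (3 / 2 * \<sigma> * (D \<omega>)\<^sup>2 + 1 / (2 * \<sigma>) * D \<omega> ^ 4))
      (L * \<sigma>\<^sup>2 * (3 / 2 * \<sigma> * \<sigma>\<^sup>2 + 1 / (2 * \<sigma>) * (3 * \<sigma> ^ 4)))"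
    by (intro has_bochner_integral_mult_right has_bochner_integral_add variance kurtosis)
  have "\<bar>\<sigma>\<^sup>2 * (2 * (E - h a)) - \<sigma>\<^sup>2 * ?\<Delta> \<sigma>\<bar>
      \<le> L * \<sigma>\<^sup>2 * (3 / 2 * \<sigma> * \<sigma>\<^sup>2 + 1 / (2 * \<sigma>) * (3 * \<sigma> ^ 4))"
    using abs_integral_le_integral[OF integrable.intros[OF gap] integrable.intros[OF dominating]
        lindeberg_regular_second_difference_quartic[OF regular normal(2)]]
    unfolding has_bochner_integral_integral_eq[OF gap] has_bochner_integral_integral_eq[OF dominating] .
  also have "\<dots> = \<sigma>\<^sup>2 * (3 * L * \<sigma> ^ 3)"
    using normal(2) by (simp add: power2_eq_square power3_eq_cube power4_eq_xxxx field_simps)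
  also have "\<sigma>\<^sup>2 * (2 * (E - h a)) - \<sigma>\<^sup>2 * ?\<Delta> \<sigma>
      = \<sigma>\<^sup>2 * (2 * (E - (h (a + \<sigma> *\<^sub>R e) + h (a - \<sigma> *\<^sub>R e)) / 2))"
    by (simp add: second_difference_def algebra_simps)
  finally show ?thesis
    using normal(2) unfolding E_def by (simp only: abs_mult) simp
qed

lemma (in prob_space) gaussian_biased_two_point_diff:
  fixes h :: "'b::euclidean_space \<Rightarrow> real"
  assumes normal: "distributed M lborel D (normal_density 0 \<sigma>)" "\<sigma> > 0"
    and regular: "lindeberg_regular L e h" and h: "h \<in> borel_measurable borel" "\<And>x. \<bar>h x\<bar> \<le> B"
  shows "\<bar>(h (a - \<sigma> *\<^sub>R e) + h (a + \<sigma> *\<^sub>R e)) / 2 + \<theta> * ((h (a - \<sigma> *\<^sub>R e) - h (a + \<sigma> *\<^sub>R e)) / 2)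
      - expectation (\<lambda>\<omega>. h (a + D \<omega> *\<^sub>R e))\<bar> \<le> L * \<sigma> * \<bar>\<theta>\<bar> + 3 / 2 * L * \<sigma> ^ 3"
proof -
  define p q where "p = h (a + \<sigma> *\<^sub>R e)" and "q = h (a - \<sigma> *\<^sub>R e)"
  have "a - \<sigma> *\<^sub>R e + (2 * \<sigma>) *\<^sub>R e = a + \<sigma> *\<^sub>R e"
    by (simp add: algebra_simps scaleR_2 flip: scaleR_scaleR)
  then have "\<bar>p - q\<bar> \<le> L * \<bar>2 * \<sigma>\<bar>"
    unfolding p_def q_def by (metis lindeberg_regular_lipschitz[OF regular])
  then have "\<bar>\<theta>\<bar> * (\<bar>q - p\<bar> / 2) \<le> \<bar>\<theta>\<bar> * (L * \<sigma>)"
    using normal(2) by (intro mult_left_mono) (auto simp: abs_minus_commute)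
  then have "\<bar>\<theta> * ((q - p) / 2)\<bar> \<le> L * \<sigma> * \<bar>\<theta>\<bar>"
    by (simp add: abs_mult mult_ac)
  moreover have "\<bar>(q + p) / 2 + x - y\<bar> \<le> \<bar>x\<bar> + \<bar>y - (p + q) / 2\<bar>" for x y by argo
  moreover have "\<bar>expectation (\<lambda>\<omega>. h (a + D \<omega> *\<^sub>R e)) - (p + q) / 2\<bar> \<le> 3 / 2 * L * \<sigma> ^ 3"
    unfolding p_def q_def by (rule gaussian_two_point_diff[OF normal regular h])
  ultimately show ?thesis unfolding p_def[symmetric] q_def[symmetric] by (meson add_mono order_trans)
qed

subsection \<open>Independence and conditioning\<close>

lemma (in prob_space) indep_set_vimage_distr_pair:
  assumes X: "X \<in> M \<rightarrow>\<^sub>M S" and Y: "Y \<in> M \<rightarrow>\<^sub>M T"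
    and indep: "indep_set (sets (vimage_algebra (space M) X S)) (sets (vimage_algebra (space M) Y T))"
  shows "distr M S X \<Otimes>\<^sub>M distr M T Y = distr M (S \<Otimes>\<^sub>M T) (\<lambda>\<omega>. (X \<omega>, Y \<omega>))"
proof (rule pair_measure_eqI)
  interpret X: prob_space "distr M S X" by (rule prob_space_distr[OF X])
  interpret Y: prob_space "distr M T Y" by (rule prob_space_distr[OF Y])
  show "sigma_finite_measure (distr M S X)" "sigma_finite_measure (distr M T Y)"
    by unfold_locales
  fix A B assume "A \<in> sets (distr M S X)" "B \<in> sets (distr M T Y)"
  then have [measurable]: "A \<in> sets S" "B \<in> sets T" by auto
  note X[measurable] Y[measurable]
  have "(\<lambda>\<omega>. (X \<omega>, Y \<omega>)) -` (A \<times> B) \<inter> space M = (X -` A \<inter> space M) \<inter> (Y -` B \<inter> space M)" by auto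
  then have "emeasure (distr M (S \<Otimes>\<^sub>M T) (\<lambda>\<omega>. (X \<omega>, Y \<omega>))) (A \<times> B)
      = prob ((X -` A \<inter> space M) \<inter> (Y -` B \<inter> space M))"
    by (simp add: emeasure_distr emeasure_eq_measure)
  also have "\<dots> = prob (X -` A \<inter> space M) * prob (Y -` B \<inter> space M)"
    by (simp add: indep_setD[OF indep] in_vimage_algebra)
  finally show "emeasure (distr M S X) A * emeasure (distr M T Y) B
      = emeasure (distr M (S \<Otimes>\<^sub>M T) (\<lambda>\<omega>. (X \<omega>, Y \<omega>))) (A \<times> B)"
    by (simp add: emeasure_distr emeasure_eq_measure ennreal_mult)
qed simp

lemma (in prob_space) expectation_distr_pair:
  fixes f :: "'b \<Rightarrow> 'c \<Rightarrow> real"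
  assumes X: "X \<in> M \<rightarrow>\<^sub>M S" and Y: "Y \<in> M \<rightarrow>\<^sub>M T"
    and prod: "distr M S X \<Otimes>\<^sub>M distr M T Y = distr M (S \<Otimes>\<^sub>M T) (\<lambda>\<omega>. (X \<omega>, Y \<omega>))"
    and f: "case_prod f \<in> borel_measurable (S \<Otimes>\<^sub>M T)"
      "\<And>x y. \<lbrakk>x \<in> space S; y \<in> space T\<rbrakk> \<Longrightarrow> \<bar>f x y\<bar> \<le> B"
  shows "expectation (\<lambda>\<omega>. f (X \<omega>) (Y \<omega>)) = expectation (\<lambda>\<omega>. \<integral>x. f x (Y \<omega>) \<partial>distr M S X)"
proof -
  note X[measurable] Y[measurable] f(1)[measurable]
  interpret X: prob_space "distr M S X" by (rule prob_space_distr[OF X])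
  interpret Y: prob_space "distr M T Y" by (rule prob_space_distr[OF Y])
  interpret XY: pair_prob_space "distr M S X" "distr M T Y" ..
  have "integrable (distr M S X \<Otimes>\<^sub>M distr M T Y) (case_prod f)"
    using f(2) by (intro XY.integrable_const_bound[of _ B] AE_I2) (auto simp: space_pair_measure)
  then have "(\<integral>y. \<integral>x. f x y \<partial>distr M S X \<partial>distr M T Y)
      = (\<integral>p. case_prod f p \<partial>distr M (S \<Otimes>\<^sub>M T) (\<lambda>\<omega>. (X \<omega>, Y \<omega>)))"
    unfolding prod[symmetric] by (rule XY.integral_snd)
  also have "\<dots> = expectation (\<lambda>\<omega>. case_prod f (X \<omega>, Y \<omega>))" by (rule integral_distr) auto
  finally show ?thesis by (subst (asm) integral_distr) auto
qed

lemma (in prob_space) measure_uniform_measure_indep: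
  assumes indep: "indep_set \<A> \<B>" and A_cond: "A \<in> \<B>" "prob A > 0" and a: "a \<in> \<A>"
  shows "measure (uniform_measure M A) a = prob a"
proof -
  have "a \<in> events" using indep_setD_ev1[OF indep] a by blast
  then have "measure (uniform_measure M A) a = prob (A \<inter> a) / prob A"
    using A_cond(2) by (intro measure_uniform_measure) (auto simp: emeasure_eq_measure)
  then show ?thesis
    using indep_setD[OF indep a A_cond(1)] A_cond(2) by (simp add: Int_commute)
qed

lemma (in prob_space) distr_uniform_measure_indep:
  assumes indep: "indep_set (sets (vimage_algebra (space M) X S)) \<B>" and A_cond: "A \<in> \<B>" "prob A > 0"
    and X: "X \<in> M \<rightarrow>\<^sub>M S"
  shows "distr (uniform_measure M A) S X = distr M S X"
proof (rule measure_eqI)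
  interpret P: prob_space "uniform_measure M A"
    using A_cond(2) by (intro prob_space_uniform_measure) (auto simp: emeasure_eq_measure)
  have X_conditioned: "X \<in> uniform_measure M A \<rightarrow>\<^sub>M S" using X by (simp cong: measurable_cong_sets)
  fix B assume "B \<in> sets (distr (uniform_measure M A) S X)"
  then have B_sets: "B \<in> sets S" by simp
  show "emeasure (distr (uniform_measure M A) S X) B = emeasure (distr M S X) B"
    using measure_uniform_measure_indep[OF indep A_cond in_vimage_algebra[OF B_sets]]
    by (simp add: emeasure_distr[OF X_conditioned B_sets] emeasure_distr[OF X B_sets] emeasure_eq_measure P.emeasure_eq_measure)
qed simp

lemma (in prob_space) indep_set_uniform_measure:
  assumes indep: "indep_set \<A> \<B>"
    and A_cond: "A \<in> \<B>" "\<And>b. b \<in> \<B> \<Longrightarrow> A \<inter> b \<in> \<B>" "prob A > 0"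
  shows "prob_space.indep_set (uniform_measure M A) \<A> \<B>"
proof -
  note events = indep_setD_ev1[OF indep] indep_setD_ev2[OF indep]
  have A_pos: "emeasure M A \<noteq> 0" "emeasure M A \<noteq> \<infinity>" using A_cond(3) by (auto simp: emeasure_eq_measure)
  interpret P: prob_space "uniform_measure M A" by (rule prob_space_uniform_measure[OF A_pos])
  have "P.prob (a \<inter> b) = P.prob a * P.prob b" if members: "a \<in> \<A>" "b \<in> \<B>" for a b
  proof -
    have ab_events: "a \<in> events" "b \<in> events" using events members by auto
    have "P.prob (a \<inter> b) = prob (a \<inter> (A \<inter> b)) / prob A"
      using measure_uniform_measure[OF A_pos, of "a \<inter> b"] ab_events by (simp add: Int_left_commute)
    also have "\<dots> = prob a * (prob (A \<inter> b) / prob A)"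
      using indep_setD[OF indep members(1) A_cond(2)[OF members(2)]] by simp
    also have "\<dots> = P.prob a * P.prob b"
      using measure_uniform_measure[OF A_pos ab_events(2)] measure_uniform_measure_indep[OF indep A_cond(1,3) members(1)] by simp
    finally show ?thesis .
  qed
  then show ?thesis using events by (intro P.indep_setI) auto
qed

lemma (in prob_space) expectation_indep_sum_split:
  fixes g :: "'b::euclidean_space \<Rightarrow> real" and D :: "nat \<Rightarrow> 'a \<Rightarrow> real"
  assumes indep: "indep_vars (\<lambda>_. borel) D {..<m}" and i: "i < m"
    and g: "g \<in> borel_measurable borel" "\<And>x. \<bar>g x\<bar> \<le> B"
  shows "expectation (\<lambda>\<omega>. g (a + (\<Sum>j=i..<m. D j \<omega> *\<^sub>R u j)))
    = expectation (\<lambda>\<omega>. expectation (\<lambda>\<omega>'. g (a + D i \<omega> *\<^sub>R u i + (\<Sum>j=Suc i..<m. D j \<omega>' *\<^sub>R u j))))"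
proof -
  let ?S = "PiM {Suc i..<m} (\<lambda>_. borel :: real measure)" and ?T = "PiM {i} (\<lambda>_. borel :: real measure)"
  let ?X = "\<lambda>\<omega>. \<lambda>j\<in>{Suc i..<m}. D j \<omega>" and ?Y = "\<lambda>\<omega>. \<lambda>j\<in>{i}. D j \<omega>"
  define f where "f x y = g (a + y i *\<^sub>R u i + (\<Sum>j=Suc i..<m. x j *\<^sub>R u j))" for x y
  have "indep_var ?S ?X ?T ?Y"
    using i by (intro indep_var_restrict[OF indep]) auto
  then have X[measurable]: "?X \<in> M \<rightarrow>\<^sub>M ?S" and Y[measurable]: "?Y \<in> M \<rightarrow>\<^sub>M ?T"
    and prod: "distr M ?S ?X \<Otimes>\<^sub>M distr M ?T ?Y = distr M (?S \<Otimes>\<^sub>M ?T) (\<lambda>\<omega>. (?X \<omega>, ?Y \<omega>))"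
    by (auto simp: indep_var_distribution_eq)
  have f[measurable]: "case_prod f \<in> borel_measurable (?S \<Otimes>\<^sub>M ?T)"
    unfolding f_def case_prod_beta' using g(1) by measurable
  have "expectation (\<lambda>\<omega>. g (a + (\<Sum>j=i..<m. D j \<omega> *\<^sub>R u j))) = expectation (\<lambda>\<omega>. f (?X \<omega>) (?Y \<omega>))"
    using i by (simp add: f_def sum.atLeast_Suc_lessThan add.assoc)
  also have "\<dots> = expectation (\<lambda>\<omega>. \<integral>x. f x (?Y \<omega>) \<partial>distr M ?S ?X)"
    by (rule expectation_distr_pair[OF X Y prod f, of B]) (simp add: f_def g(2))
  also have "\<dots> = expectation (\<lambda>\<omega>. expectation (\<lambda>\<omega>'. f (?X \<omega>') (?Y \<omega>)))"
    using f by (intro Bochner_Integration.integral_cong refl integral_distr) (auto simp: space_PiM)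
  finally show ?thesis by (simp add: f_def)
qed

subsection \<open>Levels of the hypercube\<close>

lemma finite_hypercube [simp]: "finite (hypercube K)"
  by (simp add: hypercube_def finite_PiE)

lemma card_hypercube: "card (hypercube K) = 2 ^ K"
  by (simp add: hypercube_def card_PiE numeral_2_eq_2)

lemma hypercube_cases:
  assumes "v \<in> hypercube K" "c \<in> {1..K}"
  obtains "v c = 1" | "v c = - 1"
  using assms PiE_mem[of v "{1..K}" "\<lambda>_. {-1, 1}" c] by (auto simp: hypercube_def)

definition plus_coordinates :: "nat \<Rightarrow> (nat \<Rightarrow> real) \<Rightarrow> nat set" where
  "plus_coordinates K v = {c \<in> {1..K}. v c = 1}"

lemma card_plus_coordinates_le: "card (plus_coordinates K v) \<le> K"
proof -
  have "plus_coordinates K v \<subseteq> {1..K}" by (auto simp: plus_coordinates_def)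
  from card_mono[OF _ this] show ?thesis by simp
qed

lemma coord_sum_eq_card_plus_coordinates:
  assumes "v \<in> hypercube K"
  shows "coord_sum K v = 2 * real (card (plus_coordinates K v)) - real K"
proof -
  have "coord_sum K v = (\<Sum>c=1..K. 2 * of_bool (v c = 1) - 1)"
    unfolding coord_sum_def
  proof (rule sum.cong)
    fix c assume "c \<in> {1..K}"
    then show "v c = 2 * of_bool (v c = 1) - 1"
      by (cases rule: hypercube_cases[OF assms]) auto
  qed simp
  also have "\<dots> = 2 * real (card (plus_coordinates K v)) - real K"
    by (simp add: plus_coordinates_def sum_subtractf Int_def flip: sum_distrib_left)
  finally show ?thesis .
qed

lemma bij_betw_plus_coordinates: "bij_betw (plus_coordinates K) (hypercube K) (Pow {1..K})"
proof (rule bij_betwI[where g = "\<lambda>S. \<lambda>c\<in>{1..K}. if c \<in> S then 1 else - 1"])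
  show "(\<lambda>c\<in>{1..K}. if c \<in> plus_coordinates K v then 1 else - 1) = v" if v: "v \<in> hypercube K" for v
  proof
    fix c
    show "(\<lambda>c\<in>{1..K}. if c \<in> plus_coordinates K v then 1 else - 1) c = v c"
    proof (cases "c \<in> {1..K}")
      case True
      then show ?thesis by (cases rule: hypercube_cases[OF v]) (auto simp: plus_coordinates_def)
    next
      case False
      then show ?thesis using v by (auto simp: hypercube_def)
    qed
  qed
qed (auto simp: plus_coordinates_def hypercube_def split: if_splits)

lemma card_hypercube_level: "card {v \<in> hypercube K. coord_sum K v = 2 * real j - real K} = K choose j"
proof -
  have "bij_betw (plus_coordinates K) {v \<in> hypercube K. coord_sum K v = 2 * real j - real K}
      {S \<in> Pow {1..K}. card S = j}"
    by (rule bij_betw_Collect[OF bij_betw_plus_coordinates]) (auto simp: coord_sum_eq_card_plus_coordinates)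
  then show ?thesis
    using n_subsets[of "{1..K}" j] by (simp add: bij_betw_same_card Pow_def)
qed

lemma coord_sum_flip:
  assumes "c \<in> {1..K}"
  shows "coord_sum K (flip c v) = coord_sum K v - 2 * v c"
proof -
  have "sum w {1..K} = w c + sum w ({1..K} - {c})" for w :: "nat \<Rightarrow> real"
    using assms by (intro sum.remove) auto
  from this[of v] this[of "flip c v"] show ?thesis by (simp add: coord_sum_def flip_def)
qed

lemma hypercube_coordinate_average:
  assumes "v \<in> hypercube K" "K \<ge> 1"
  shows "(\<Sum>c=1..K. f (v c)) / real K
    = (f 1 + f (- 1)) / 2 + coord_sum K v / real K * ((f 1 - f (- 1)) / 2 :: real)"
proof -
  have "(\<Sum>c=1..K. f (v c)) = (\<Sum>c=1..K. (f 1 + f (- 1)) / 2 + v c * ((f 1 - f (- 1)) / 2))"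
  proof (rule sum.cong)
    fix c assume "c \<in> {1..K}"
    then show "f (v c) = (f 1 + f (- 1)) / 2 + v c * ((f 1 - f (- 1)) / 2)"
      by (cases rule: hypercube_cases[OF assms(1)]) (auto simp: field_simps)
  qed simp
  also have "\<dots> = real K * ((f 1 + f (- 1)) / 2) + coord_sum K v * ((f 1 - f (- 1)) / 2)"
    by (simp add: sum.distrib sum_distrib_right coord_sum_def)
  finally show ?thesis using assms(2) by (simp add: field_simps)
qed

subsection \<open>The walk from an arbitrary initial law\<close>

locale coordinate_flip_walk = prob_space M for M :: "'a measure" +
  fixes K :: nat and Y :: "nat \<Rightarrow> 'a \<Rightarrow> nat \<Rightarrow> real" and C :: "nat \<Rightarrow> 'a \<Rightarrow> nat"
  assumes Y_measurable: "Y i \<in> M \<rightarrow>\<^sub>M count_space (hypercube K)"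
    and C_measurable: "C i \<in> M \<rightarrow>\<^sub>M count_space {1..K}"
    and C_uniform: "distr M (count_space {1..K}) (C i) = uniform_count_measure {1..K}"
    and C_indep: "indep_set (sets (vimage_algebra (space M) (C i) (count_space {1..K})))
          (sets (vimage_algebra (space M) (\<lambda>\<omega>. \<lambda>j\<in>{..i}. Y j \<omega>)
             (Pi\<^sub>M {..i} (\<lambda>_. count_space (hypercube K)))))"
    and Y_Suc: "\<omega> \<in> space M \<Longrightarrow> Y (Suc i) \<omega> = flip (C i \<omega>) (Y i \<omega>)"
begin

definition X :: "nat \<Rightarrow> 'a \<Rightarrow> real" where
  "X i \<omega> = coord_sum K (Y i \<omega>)"

definition path :: "nat \<Rightarrow> 'a \<Rightarrow> nat \<Rightarrow> nat \<Rightarrow> real" where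
  "path i \<omega> = (\<lambda>j\<in>{..i}. Y j \<omega>)"

abbreviation path_space :: "nat \<Rightarrow> (nat \<Rightarrow> nat \<Rightarrow> real) measure" where
  "path_space i \<equiv> Pi\<^sub>M {..i} (\<lambda>_. count_space (hypercube K))"

definition adapted :: "nat \<Rightarrow> ('a \<Rightarrow> 'b) \<Rightarrow> bool" where
  "adapted i f \<longleftrightarrow> (\<forall>\<omega> \<omega>'. (\<forall>j\<le>i. Y j \<omega> = Y j \<omega>') \<longrightarrow> f \<omega> = f \<omega>')"

lemma Y_in: "\<omega> \<in> space M \<Longrightarrow> Y i \<omega> \<in> hypercube K"
  using measurable_space[OF Y_measurable] by simp

lemma C_in: "\<omega> \<in> space M \<Longrightarrow> C i \<omega> \<in> {1..K}"
  using measurable_space[OF C_measurable] by (metis space_count_space)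

lemma K_ge_1: "K \<ge> 1"
proof -
  obtain \<omega> where "\<omega> \<in> space M" using not_empty by blast
  then show ?thesis using C_in[of \<omega> 0] by simp
qed

lemma X_Suc: "\<omega> \<in> space M \<Longrightarrow> X (Suc i) \<omega> = X i \<omega> - 2 * Y i \<omega> (C i \<omega>)"
  by (simp add: X_def Y_Suc coord_sum_flip[OF C_in])

lemma path_space_eq: "path_space i = count_space ({..i} \<rightarrow>\<^sub>E hypercube K)"
  by (rule count_space_PiM_finite) (auto intro: countable_finite)

lemma finite_paths: "finite ({..i::nat} \<rightarrow>\<^sub>E hypercube K)"
  by (rule finite_PiE) auto

lemma path_measurable: "path i \<in> M \<rightarrow>\<^sub>M path_space i"
  unfolding path_def[abs_def] by (intro measurable_restrict Y_measurable)

lemma path_in: "\<omega> \<in> space M \<Longrightarrow> path i \<omega> \<in> {..i} \<rightarrow>\<^sub>E hypercube K"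
  by (auto simp: path_def Y_in)

lemma adapted_factor:
  assumes "adapted i f"
  obtains F where "\<And>\<omega>. f \<omega> = F (path i \<omega>)"
proof
  fix \<omega>
  let ?\<omega>' = "SOME \<omega>'. path i \<omega>' = path i \<omega>"
  have same_path: "path i ?\<omega>' = path i \<omega>" by (rule someI) (rule refl)
  have "Y j \<omega> = Y j ?\<omega>'" if "j \<le> i" for j
    using fun_cong[OF same_path, of j] that by (simp add: path_def)
  then show "f \<omega> = f ?\<omega>'" using assms unfolding adapted_def by blast
qed

lemma adapted_integrable:
  fixes f :: "'a \<Rightarrow> real"
  assumes "adapted i f"
  shows "integrable M f"
proof -
  obtain F where f_eq: "\<And>\<omega>. f \<omega> = F (path i \<omega>)" using adapted_factor[OF assms] by blast
  have "norm (F (path i \<omega>)) \<le> (\<Sum>p\<in>{..i} \<rightarrow>\<^sub>E hypercube K. norm (F p))" if "\<omega> \<in> space M" for \<omega>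
    using path_in[OF that] by (intro member_le_sum finite_paths) auto
  moreover have "(\<lambda>\<omega>. F (path i \<omega>)) \<in> borel_measurable M"
    by (rule measurable_compose[OF path_measurable]) (simp add: path_space_eq)
  ultimately show ?thesis unfolding f_eq
    by (intro integrable_const_bound[of _ "\<Sum>p\<in>{..i} \<rightarrow>\<^sub>E hypercube K. norm (F p)"]) auto
qed

lemma expectation_path_coordinate:
  fixes F :: "nat \<Rightarrow> (nat \<Rightarrow> nat \<Rightarrow> real) \<Rightarrow> real"
  shows "expectation (\<lambda>\<omega>. F (C i \<omega>) (path i \<omega>)) = expectation (\<lambda>\<omega>. (\<Sum>c=1..K. F c (path i \<omega>)) / real K)"
proof -
  have "expectation (\<lambda>\<omega>. F (C i \<omega>) (path i \<omega>))
      = expectation (\<lambda>\<omega>. \<integral>c. F c (path i \<omega>) \<partial>distr M (count_space {1..K}) (C i))"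
  proof (rule expectation_distr_pair[OF C_measurable path_measurable])
    show "distr M (count_space {1..K}) (C i) \<Otimes>\<^sub>M distr M (path_space i) (path i)
        = distr M (count_space {1..K} \<Otimes>\<^sub>M path_space i) (\<lambda>\<omega>. (C i \<omega>, path i \<omega>))"
      using C_indep[of i] by (intro indep_set_vimage_distr_pair C_measurable path_measurable) (simp add: path_def[abs_def])
    show "case_prod F \<in> borel_measurable (count_space {1..K} \<Otimes>\<^sub>M path_space i)"
      by (simp add: path_space_eq pair_measure_count_space finite_paths)
    show "\<bar>F c p\<bar> \<le> (\<Sum>(c, p)\<in>{1..K} \<times> ({..i} \<rightarrow>\<^sub>E hypercube K). \<bar>F c p\<bar>)"
      if "c \<in> space (count_space {1..K})" "p \<in> space (path_space i)" for c p
      using member_le_sum[of "(c, p)" "{1..K} \<times> ({..i} \<rightarrow>\<^sub>E hypercube K)" "\<lambda>(c, p). \<bar>F c p\<bar>"] that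
      by (simp add: path_space_eq finite_paths case_prod_beta')
  qed
  then show ?thesis
    unfolding C_uniform by (simp add: integral_uniform_count_measure)
qed

lemma expectation_step:
  fixes G :: "'a \<Rightarrow> real \<Rightarrow> real"
  assumes "adapted i G"
  shows "expectation (\<lambda>\<omega>. G \<omega> (Y i \<omega> (C i \<omega>)))
    = expectation (\<lambda>\<omega>. (G \<omega> 1 + G \<omega> (- 1)) / 2 + X i \<omega> / real K * ((G \<omega> 1 - G \<omega> (- 1)) / 2))"
proof -
  obtain F where G_eq: "\<And>\<omega>. G \<omega> = F (path i \<omega>)" using adapted_factor[OF assms] by blast
  have "expectation (\<lambda>\<omega>. G \<omega> (Y i \<omega> (C i \<omega>))) = expectation (\<lambda>\<omega>. F (path i \<omega>) (path i \<omega> i (C i \<omega>)))"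
    by (simp add: G_eq path_def)
  also have "\<dots> = expectation (\<lambda>\<omega>. (\<Sum>c=1..K. F (path i \<omega>) (path i \<omega> i c)) / real K)"
    by (rule expectation_path_coordinate[of "\<lambda>c p. F p (p i c)"])
  also have "\<dots> = expectation (\<lambda>\<omega>. (\<Sum>c=1..K. G \<omega> (Y i \<omega> c)) / real K)"
    by (simp add: G_eq path_def)
  also have "\<dots> = expectation (\<lambda>\<omega>. (G \<omega> 1 + G \<omega> (- 1)) / 2 + X i \<omega> / real K * ((G \<omega> 1 - G \<omega> (- 1)) / 2))"
    unfolding X_def
    by (intro Bochner_Integration.integral_cong refl hypercube_coordinate_average Y_in K_ge_1)
  finally show ?thesis .
qed

lemma coordinate_flip_walk_conditioned:
  assumes pos: "prob {\<omega> \<in> space M. Y 0 \<omega> \<in> V} > 0"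
  shows "coordinate_flip_walk (uniform_measure M {\<omega> \<in> space M. Y 0 \<omega> \<in> V}) K Y C"
proof -
  define A where "A = {\<omega> \<in> space M. Y 0 \<omega> \<in> V}"
  let ?P = "uniform_measure M A"
  let ?\<C> = "\<lambda>i. sets (vimage_algebra (space M) (C i) (count_space {1..K}))"
  let ?\<F> = "\<lambda>i. sets (vimage_algebra (space M) (path i) (path_space i))"
  have prob_A: "prob A > 0" using pos by (simp add: A_def)
  then interpret P: prob_space ?P
    by (intro prob_space_uniform_measure) (auto simp: emeasure_eq_measure)
  have indep: "indep_set (?\<C> i) (?\<F> i)" for i
    using C_indep by (simp add: path_def[abs_def])
  have A_past: "A \<in> ?\<F> i" for i
  proof -
    have "{p \<in> {..i} \<rightarrow>\<^sub>E hypercube K. p 0 \<in> V} \<in> sets (path_space i)" by (auto simp: path_space_eq)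
    moreover have "path i -` {p \<in> {..i} \<rightarrow>\<^sub>E hypercube K. p 0 \<in> V} \<inter> space M = A"
      using path_in by (auto simp: A_def path_def)
    ultimately show ?thesis using in_vimage_algebra by blast
  qed
  have past_Int: "b \<in> ?\<F> i \<Longrightarrow> A \<inter> b \<in> ?\<F> i" for b i
    using A_past by (rule sets.Int)
  show ?thesis
    unfolding A_def[symmetric]
  proof unfold_locales
    fix i
    show "Y i \<in> ?P \<rightarrow>\<^sub>M count_space (hypercube K)"
      using Y_measurable by (simp cong: measurable_cong_sets)
    show "C i \<in> ?P \<rightarrow>\<^sub>M count_space {1..K}"
      using C_measurable by (simp cong: measurable_cong_sets)
    show "distr ?P (count_space {1..K}) (C i) = uniform_count_measure {1..K}"
      by (simp only: distr_uniform_measure_indep[OF indep A_past prob_A C_measurable] C_uniform)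
    show "P.indep_set (sets (vimage_algebra (space ?P) (C i) (count_space {1..K})))
        (sets (vimage_algebra (space ?P) (\<lambda>\<omega>. \<lambda>j\<in>{..i}. Y j \<omega>) (path_space i)))"
      using indep_set_uniform_measure[OF indep A_past past_Int prob_A] by (simp add: path_def[abs_def])
    show "Y (Suc i) \<omega> = flip (C i \<omega>) (Y i \<omega>)" if "\<omega> \<in> space ?P" for \<omega>
      using that by (simp add: Y_Suc)
  qed
qed

lemma second_moment_deviation:
  "expectation (\<lambda>\<omega>. (X i \<omega> - (1 - 2 / real K) ^ i * X 0 \<omega>)\<^sup>2) \<le> 4 * real i"
proof (induction i)
  case (Suc i)
  define \<rho> where "\<rho> = 1 - 2 / real K"
  define G where "G \<omega> y = (X i \<omega> - 2 * y - \<rho> ^ Suc i * X 0 \<omega>)\<^sup>2" for \<omega> y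
  let ?E = "\<lambda>\<omega>. (G \<omega> 1 + G \<omega> (- 1)) / 2 + X i \<omega> / real K * ((G \<omega> 1 - G \<omega> (- 1)) / 2)"
  let ?D = "\<lambda>\<omega>. (X i \<omega> - \<rho> ^ i * X 0 \<omega>)\<^sup>2"
  have int: "integrable M ?E" "integrable M ?D"
    by (auto intro!: adapted_integrable[of i] simp: adapted_def X_def G_def)
  have mean_step: "?E \<omega> \<le> ?D \<omega> + 4" for \<omega>
  proof -
    define \<kappa> u q where "\<kappa> = \<rho> ^ i * X 0 \<omega>" and "u = X i \<omega> - \<kappa>" and "q = 1 / real K"
    have "0 \<le> q" "q \<le> 1" using K_ge_1 by (auto simp: q_def)
    have "0 \<le> 4 * u\<^sup>2 * (q * (1 - q)) + 4 * (q * (\<kappa> + u))\<^sup>2"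
      using \<open>0 \<le> q\<close> \<open>q \<le> 1\<close> by (intro add_nonneg_nonneg mult_nonneg_nonneg) auto
    also have "\<dots> = u\<^sup>2 + 4 - (((u + \<kappa> - 2 - (1 - 2 * q) * \<kappa>)\<^sup>2 + (u + \<kappa> + 2 - (1 - 2 * q) * \<kappa>)\<^sup>2) / 2
        + (u + \<kappa>) * q * (((u + \<kappa> - 2 - (1 - 2 * q) * \<kappa>)\<^sup>2 - (u + \<kappa> + 2 - (1 - 2 * q) * \<kappa>)\<^sup>2) / 2))"
      by (simp add: power2_eq_square field_simps)
    finally show ?thesis
      by (simp add: G_def \<kappa>_def u_def q_def \<rho>_def mult.assoc)
  qed
  have "expectation (\<lambda>\<omega>. (X (Suc i) \<omega> - \<rho> ^ Suc i * X 0 \<omega>)\<^sup>2) = expectation (\<lambda>\<omega>. G \<omega> (Y i \<omega> (C i \<omega>)))"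
    by (intro Bochner_Integration.integral_cong) (auto simp: G_def X_Suc)
  also have "\<dots> = expectation ?E"
    by (rule expectation_step) (simp add: adapted_def X_def G_def[abs_def])
  also have "\<dots> \<le> expectation (\<lambda>\<omega>. ?D \<omega> + 4)"
    using int mean_step by (intro integral_mono) auto
  also have "\<dots> \<le> 4 * real (Suc i)"
    using Suc.IH int by (simp add: \<rho>_def prob_space)
  finally show ?case by (simp add: \<rho>_def)
qed simp

lemma first_moment_le: "expectation (\<lambda>\<omega>. \<bar>X i \<omega>\<bar>) \<le> expectation (\<lambda>\<omega>. \<bar>X 0 \<omega>\<bar>) + 2 * sqrt (real i)"
proof -
  define \<rho> where "\<rho> = (1 - 2 / real K) ^ i"
  define D where "D \<omega> = X i \<omega> - \<rho> * X 0 \<omega>" for \<omega>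
  have int: "integrable M (\<lambda>\<omega>. \<bar>X i \<omega>\<bar>)" "integrable M (\<lambda>\<omega>. \<bar>X 0 \<omega>\<bar>)" "integrable M (\<lambda>\<omega>. \<bar>D \<omega>\<bar>)"
      "integrable M (\<lambda>\<omega>. (D \<omega>)\<^sup>2)"
    by (auto intro!: adapted_integrable[of i] simp del: integrable_abs simp: adapted_def X_def D_def)
  have "\<bar>1 - 2 / real K\<bar> \<le> 1" using K_ge_1 by (auto simp: abs_le_iff field_simps)
  then have "\<bar>\<rho>\<bar> \<le> 1" unfolding \<rho>_def power_abs by (intro power_le_one) auto
  then have pointwise: "\<bar>X i \<omega>\<bar> \<le> \<bar>X 0 \<omega>\<bar> + \<bar>D \<omega>\<bar>" for \<omega>
    using mult_left_le_one_le[of "\<bar>X 0 \<omega>\<bar>" "\<bar>\<rho>\<bar>"] by (simp add: D_def abs_mult[symmetric])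
  have "(expectation (\<lambda>\<omega>. \<bar>D \<omega>\<bar>))\<^sup>2 \<le> expectation (\<lambda>\<omega>. (D \<omega>)\<^sup>2)"
    using variance_eq[of "\<lambda>\<omega>. \<bar>D \<omega>\<bar>"] variance_positive[of "\<lambda>\<omega>. \<bar>D \<omega>\<bar>"] int by simp
  also have "\<dots> \<le> 4 * real i" unfolding D_def \<rho>_def by (rule second_moment_deviation)
  finally have "expectation (\<lambda>\<omega>. \<bar>D \<omega>\<bar>) \<le> 2 * sqrt (real i)"
    using real_le_rsqrt[of _ "4 * real i"] by (simp add: real_sqrt_mult)
  moreover have "expectation (\<lambda>\<omega>. \<bar>X i \<omega>\<bar>) \<le> expectation (\<lambda>\<omega>. \<bar>X 0 \<omega>\<bar> + \<bar>D \<omega>\<bar>)"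
    using int pointwise by (intro integral_mono) auto
  ultimately show ?thesis using int by simp
qed

lemma return_moment_le:
  fixes n T R :: real
  assumes n_pos: "n > 0" and i_le: "real i \<le> T * n" and contraction: "(1 - 2 / real K) ^ i \<ge> 1 / 2"
  shows "expectation (\<lambda>\<omega>. of_bool (\<bar>X i \<omega>\<bar> \<le> R * sqrt n) * (1 + (X 0 \<omega>)\<^sup>2 / n)) \<le> 1 + 8 * R\<^sup>2 + 32 * T"
proof -
  define D where "D \<omega> = X i \<omega> - (1 - 2 / real K) ^ i * X 0 \<omega>" for \<omega>
  have pointwise: "of_bool (\<bar>X i \<omega>\<bar> \<le> R * sqrt n) * (1 + (X 0 \<omega>)\<^sup>2 / n) \<le> 1 + 8 * R\<^sup>2 + 8 / n * (D \<omega>)\<^sup>2" for \<omega>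
  proof (cases "\<bar>X i \<omega>\<bar> \<le> R * sqrt n")
    case True
    have "\<bar>X 0 \<omega>\<bar> * (1 / 2) \<le> \<bar>X 0 \<omega>\<bar> * (1 - 2 / real K) ^ i" using contraction by (intro mult_left_mono) auto
    also have "\<dots> = \<bar>(1 - 2 / real K) ^ i * X 0 \<omega>\<bar>" using contraction by (simp add: abs_mult)
    also have "\<dots> \<le> \<bar>D \<omega>\<bar> + R * sqrt n" unfolding D_def using True by linarith
    finally have "\<bar>X 0 \<omega>\<bar>\<^sup>2 \<le> (2 * (\<bar>D \<omega>\<bar> + R * sqrt n))\<^sup>2" by (intro power_mono) auto
    also have "\<dots> \<le> 8 * (D \<omega>)\<^sup>2 + 8 * R\<^sup>2 * n"
    proof -
      have "(2 * (a + b))\<^sup>2 \<le> 8 * a\<^sup>2 + 8 * b\<^sup>2" for a b :: real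
        using zero_le_power2[of "a - b"] by (simp add: power2_eq_square algebra_simps)
      from this[of "\<bar>D \<omega>\<bar>" "R * sqrt n"] show ?thesis using n_pos by (simp add: power_mult_distrib)
    qed
    finally have "(X 0 \<omega>)\<^sup>2 / n \<le> (8 * (D \<omega>)\<^sup>2 + 8 * R\<^sup>2 * n) / n"
      using n_pos by (intro divide_right_mono) auto
    then show ?thesis using True n_pos by (simp add: add_divide_distrib)
  qed (use n_pos in simp)
  have int: "integrable M (\<lambda>\<omega>. of_bool (\<bar>X i \<omega>\<bar> \<le> R * sqrt n) * (1 + (X 0 \<omega>)\<^sup>2 / n))" "integrable M (\<lambda>\<omega>. (D \<omega>)\<^sup>2)"
    by (auto intro!: adapted_integrable[of i] simp: adapted_def X_def D_def)
  have "expectation (\<lambda>\<omega>. of_bool (\<bar>X i \<omega>\<bar> \<le> R * sqrt n) * (1 + (X 0 \<omega>)\<^sup>2 / n))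
      \<le> expectation (\<lambda>\<omega>. 1 + 8 * R\<^sup>2 + 8 / n * (D \<omega>)\<^sup>2)"
    using int pointwise by (intro integral_mono) auto
  also have "\<dots> = 1 + 8 * R\<^sup>2 + 8 / n * expectation (\<lambda>\<omega>. (D \<omega>)\<^sup>2)"
    using int by (simp add: prob_space)
  also have "\<dots> \<le> 1 + 8 * R\<^sup>2 + 8 / n * (4 * (T * n))"
    unfolding D_def using n_pos i_le
    by (intro add_left_mono mult_left_mono order_trans[OF second_moment_deviation]) auto
  also have "\<dots> = 1 + 8 * R\<^sup>2 + 32 * T" using n_pos by simp
  finally show ?thesis .
qed

lemma step_gaussian_diff:
  fixes h :: "'c::euclidean_space \<Rightarrow> real"
  assumes N: "prob_space N" and normal: "distributed N lborel D (normal_density 0 (2 * r))" and r: "r > 0"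
    and regular: "lindeberg_regular L e h" and h: "h \<in> borel_measurable borel" "\<And>x. \<bar>h x\<bar> \<le> B"
    and A_adapted: "adapted i A"
  shows "\<bar>expectation (\<lambda>\<omega>. h (A \<omega> + (r * (X (Suc i) \<omega> - X i \<omega>)) *\<^sub>R e))
      - expectation (\<lambda>\<omega>. LINT \<omega>'|N. h (A \<omega> + D \<omega>' *\<^sub>R e))\<bar>
    \<le> 2 * L * r / real K * expectation (\<lambda>\<omega>. \<bar>X i \<omega>\<bar>) + 12 * L * r ^ 3"
proof -
  interpret N: prob_space N by (rule N)
  define G where "G \<omega> y = h (A \<omega> - (2 * r * y) *\<^sub>R e)" for \<omega> y
  let ?E = "\<lambda>\<omega>. (G \<omega> 1 + G \<omega> (- 1)) / 2 + X i \<omega> / real K * ((G \<omega> 1 - G \<omega> (- 1)) / 2)"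
  let ?N = "\<lambda>\<omega>. LINT \<omega>'|N. h (A \<omega> + D \<omega>' *\<^sub>R e)"
  let ?R = "\<lambda>\<omega>. 2 * L * r / real K * \<bar>X i \<omega>\<bar> + 12 * L * r ^ 3"
  have A_cong: "A \<omega> = A \<omega>'" if "\<forall>j\<le>i. Y j \<omega> = Y j \<omega>'" for \<omega> \<omega>'
    using A_adapted that unfolding adapted_def by blast
  have int: "integrable M ?E" "integrable M ?N"
    by (rule adapted_integrable[of i], simp add: adapted_def X_def G_def, metis A_cong order_refl)+
  have int_X: "integrable M (X i)"
    by (rule adapted_integrable[of i]) (simp add: adapted_def X_def)
  have "expectation (\<lambda>\<omega>. h (A \<omega> + (r * (X (Suc i) \<omega> - X i \<omega>)) *\<^sub>R e)) = expectation (\<lambda>\<omega>. G \<omega> (Y i \<omega> (C i \<omega>)))"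
    by (intro Bochner_Integration.integral_cong refl) (simp add: G_def X_Suc algebra_simps)
  also have "\<dots> = expectation ?E"
    by (rule expectation_step) (unfold adapted_def G_def[abs_def], metis A_cong)
  finally have gap: "expectation (\<lambda>\<omega>. h (A \<omega> + (r * (X (Suc i) \<omega> - X i \<omega>)) *\<^sub>R e)) - expectation ?N
      = expectation (\<lambda>\<omega>. ?E \<omega> - ?N \<omega>)"
    using int by simp
  have "\<bar>expectation (\<lambda>\<omega>. ?E \<omega> - ?N \<omega>)\<bar> \<le> expectation ?R"
  proof (rule abs_integral_le_integral)
    show "\<bar>?E \<omega> - ?N \<omega>\<bar> \<le> ?R \<omega>" for \<omega>
      using N.gaussian_biased_two_point_diff[OF normal _ regular h, of "A \<omega>" "X i \<omega> / real K"] r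
      by (simp add: G_def power_mult_distrib abs_divide)
  qed (use int int_X in auto)
  then show ?thesis
    unfolding gap using int_X by (simp add: prob_space)
qed

lemma lindeberg_exchange:
  fixes g :: "'c::euclidean_space \<Rightarrow> real" and D :: "nat \<Rightarrow> 'b \<Rightarrow> real" and v :: "real \<Rightarrow> 'c"
  assumes N: "prob_space N" and indep: "prob_space.indep_vars N (\<lambda>_. borel) D {..<m}"
    and normal: "\<And>j. j < m \<Longrightarrow> distributed N lborel (D j) (normal_density 0 (2 * r))" and r: "r > 0"
    and regular: "\<And>j. j < m \<Longrightarrow> lindeberg_regular L (e j) g"
    and g: "g \<in> borel_measurable borel" "\<And>x. \<bar>g x\<bar> \<le> B"
    and moment: "\<And>j. j < m \<Longrightarrow> expectation (\<lambda>\<omega>. \<bar>X j \<omega>\<bar>) \<le> b"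
  shows "\<bar>expectation (\<lambda>\<omega>. g (v (X 0 \<omega>) + (\<Sum>j<m. (r * (X (Suc j) \<omega> - X j \<omega>)) *\<^sub>R e j)))
      - expectation (\<lambda>\<omega>. LINT \<omega>'|N. g (v (X 0 \<omega>) + (\<Sum>j<m. D j \<omega>' *\<^sub>R e j)))\<bar>
    \<le> real m * (2 * L * r / real K * b + 12 * L * r ^ 3)"
proof -
  interpret N: prob_space N by (rule N)
  define S where "S i = (\<lambda>\<omega>. \<Sum>j=i..<m. D j \<omega> *\<^sub>R e j)" for i
  have [measurable]: "D j \<in> borel_measurable N" if "j < m" for j
    using distributed_measurable[OF normal[OF that]] by simp
  have S[measurable]: "S i \<in> borel_measurable N" for i
    unfolding S_def by (intro borel_measurable_sum borel_measurable_scaleR) auto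
  define H where "H i a = N.expectation (\<lambda>\<omega>. g (a + S i \<omega>))" for i a
  define A where "A i \<omega> = v (X 0 \<omega>) + (\<Sum>j<i. (r * (X (Suc j) \<omega> - X j \<omega>)) *\<^sub>R e j)" for i \<omega>
  define U where "U i = expectation (\<lambda>\<omega>. H i (A i \<omega>))" for i
    \<comment> \<open>the first \<open>i\<close> steps come from the walk, the others from the Gaussian variables\<close>
  have H_bounded: "H i \<in> borel_measurable borel" "\<And>a. \<bar>H i a\<bar> \<le> B" for i
    unfolding H_def using g by (measurable, intro N.abs_expectation_le)
  have H_regular: "lindeberg_regular L (e j) (H i)" if "j < m" for i j
    unfolding H_def[abs_def] by (rule N.lindeberg_regular_expectation[OF regular[OF that] g S])
  have exchange: "\<bar>U (Suc i) - U i\<bar> \<le> 2 * L * r / real K * b + 12 * L * r ^ 3" if i: "i < m" for i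
  proof -
    have "H i a = N.expectation (\<lambda>\<omega>. H (Suc i) (a + D i \<omega> *\<^sub>R e i))" for a
      unfolding H_def S_def by (rule N.expectation_indep_sum_split[OF indep i g])
    then have U_eq: "U i = expectation (\<lambda>\<omega>. LINT \<omega>'|N. H (Suc i) (A i \<omega> + D i \<omega>' *\<^sub>R e i))"
      unfolding U_def by simp
    have "adapted i (A i)" by (simp add: adapted_def A_def X_def)
    from step_gaussian_diff[OF N normal[OF i] r H_regular[OF i] H_bounded this]
    have "\<bar>U (Suc i) - U i\<bar> \<le> 2 * L * r / real K * expectation (\<lambda>\<omega>. \<bar>X i \<omega>\<bar>) + 12 * L * r ^ 3"
      unfolding U_eq by (simp add: U_def A_def add.assoc)
    also have "\<dots> \<le> 2 * L * r / real K * b + 12 * L * r ^ 3"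
      using lindeberg_regular_nonneg[OF regular[OF i]] r by (intro add_right_mono mult_left_mono moment i) auto
    finally show ?thesis .
  qed
  have "\<bar>U m - U 0\<bar> = \<bar>\<Sum>i<m. U (Suc i) - U i\<bar>" by (simp add: sum_lessThan_telescope)
  also have "\<dots> \<le> real m * (2 * L * r / real K * b + 12 * L * r ^ 3)"
    using exchange sum_bounded_above[of "{..<m}" "\<lambda>i. \<bar>U (Suc i) - U i\<bar>"] by (intro order_trans[OF sum_abs]) simp
  finally show ?thesis
    by (simp add: U_def H_def S_def A_def N.prob_space atLeast0LessThan)
qed

end

subsection \<open>The rescaled marginals\<close>

abbreviation steps :: "nat \<Rightarrow> real \<Rightarrow> nat" where
  "steps n s \<equiv> nat \<lfloor>real n * s\<rfloor>"

lemma steps_mono: "s \<le> s' \<Longrightarrow> steps n s \<le> steps n s'"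
  by (intro nat_mono floor_mono mult_left_mono) auto

lemma steps_le: "0 \<le> s \<Longrightarrow> real (steps n s) \<le> s * real n"
  by (simp add: mult.commute)

lemma steps_divide_tendsto:
  assumes "0 \<le> s"
  shows "(\<lambda>n. real (steps n s) / real n) \<longlonglongrightarrow> s"
proof (rule tendsto_sandwich)
  show "\<forall>\<^sub>F n in sequentially. s - 1 / real n \<le> real (steps n s) / real n"
    using eventually_ge_at_top[of 1]
  proof eventually_elim
    case (elim n)
    have "(real n * s - 1) / real n \<le> real (steps n s) / real n"
      by (intro divide_right_mono) linarith+
    then show ?case using elim by (simp add: diff_divide_distrib)
  qed
  show "\<forall>\<^sub>F n in sequentially. real (steps n s) / real n \<le> s"
    using eventually_ge_at_top[of 1] by eventually_elim (simp add: divide_le_eq mult.commute[of s] assms)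
  show "(\<lambda>n. s - 1 / real n) \<longlonglongrightarrow> s"
    using tendsto_diff[OF tendsto_const lim_1_over_n, of s] by simp
qed simp

definition increment_direction :: "nat \<Rightarrow> ('s::finite \<Rightarrow> real) \<Rightarrow> nat \<Rightarrow> real ^ 's" where
  "increment_direction n t j = (\<chi> i. of_bool (j < steps n (t i)))"

lemma sum_increment_direction:
  fixes x :: "nat \<Rightarrow> real"
  assumes "\<And>i. steps n (t i) \<le> m"
  shows "(\<Sum>j<m. (c * (x (Suc j) - x j)) *\<^sub>R increment_direction n t j) = (\<chi> i. c * (x (steps n (t i)) - x 0))"
  unfolding vec_eq_iff
proof
  fix i
  have "(\<Sum>j<m. c * (x (Suc j) - x j) * of_bool (j < steps n (t i))) = (\<Sum>j<steps n (t i). c * (x (Suc j) - x j))"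
    using assms[of i] by (intro sum.mono_neutral_cong_right) auto
  also have "\<dots> = c * (x (steps n (t i)) - x 0)"
    by (simp only: sum_distrib_left[symmetric] sum_lessThan_telescope)
  finally show "(\<Sum>j<m. (c * (x (Suc j) - x j)) *\<^sub>R increment_direction n t j) $ i
      = (\<chi> i. c * (x (steps n (t i)) - x 0)) $ i"
    by (simp add: increment_direction_def)
qed

lemma borel_measurable_vec_lambda:
  fixes f :: "'n::finite \<Rightarrow> 'a \<Rightarrow> real"
  assumes "\<And>i. f i \<in> borel_measurable M"
  shows "(\<lambda>\<omega>. \<chi> i. f i \<omega>) \<in> borel_measurable M"
proof (subst borel_measurable_euclidean_space, rule ballI)
  fix b :: "real ^ 'n" assume "b \<in> Basis"
  then obtain i where "b = axis i 1" by (auto simp: Basis_vec_def)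
  then have "(\<lambda>\<omega>. (\<chi> i. f i \<omega>) \<bullet> b) = f i" by (simp add: inner_axis)
  then show "(\<lambda>\<omega>. (\<chi> i. f i \<omega>) \<bullet> b) \<in> borel_measurable M" using assms[of i] by simp
qed

subsection \<open>Brownian motion on a grid\<close>

locale brownian_motion = prob_space N for N :: "'b measure" +
  fixes W :: "real \<Rightarrow> 'b \<Rightarrow> real"
  assumes brownian: "standard_brownian_motion N W"
begin

lemma W_measurable [measurable]: "s \<ge> 0 \<Longrightarrow> W s \<in> borel_measurable N"
  using brownian by (simp add: standard_brownian_motion_def)

definition grid_increment :: "nat \<Rightarrow> nat \<Rightarrow> 'b \<Rightarrow> real" where
  "grid_increment n j \<omega> = 2 * (W (real (Suc j) / real n) \<omega> - W (real j / real n) \<omega>)"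

definition grid_marginals :: "nat \<Rightarrow> ('s::finite \<Rightarrow> real) \<Rightarrow> 'b \<Rightarrow> real ^ 's" where
  "grid_marginals n t \<omega> = (\<chi> i. 2 * (W (real (steps n (t i)) / real n) \<omega> - W 0 \<omega>))"

lemma grid_increment_distributed:
  assumes "n \<ge> 1"
  shows "distributed N lborel (grid_increment n j) (normal_density 0 (2 * (1 / sqrt (real n))))"
proof -
  have "0 \<le> real j / real n" "real j / real n < real (Suc j) / real n"
    using assms by (auto simp: divide_strict_right_mono)
  then have "distributed N lborel (\<lambda>\<omega>. W (real (Suc j) / real n) \<omega> - W (real j / real n) \<omega>)
      (normal_density 0 (sqrt (real (Suc j) / real n - real j / real n)))"
    using brownian unfolding standard_brownian_motion_def by blast
  moreover have "sqrt (real (Suc j) / real n - real j / real n) = 1 / sqrt (real n)"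
    by (simp add: real_sqrt_divide flip: diff_divide_distrib)
  ultimately have "distributed N lborel (\<lambda>\<omega>. W (real (Suc j) / real n) \<omega> - W (real j / real n) \<omega>)
      (normal_density 0 (1 / sqrt (real n)))" by simp
  from normal_density_affine[OF this, of 2 0] show ?thesis
    using assms by (simp add: grid_increment_def[abs_def])
qed

lemma grid_increment_indep:
  assumes "n \<ge> 1"
  shows "indep_vars (\<lambda>_. borel) (grid_increment n) {..<m}"
proof -
  have "strict_mono_on {..m} (\<lambda>j. real j / real n)"
    using assms by (auto simp: strict_mono_on_def divide_strict_right_mono)
  moreover have "\<forall>u :: nat \<Rightarrow> real. 0 \<le> u 0 \<and> strict_mono_on {..m} u \<longrightarrow>
      indep_vars (\<lambda>_. borel) (\<lambda>j \<omega>. W (u (Suc j)) \<omega> - W (u j) \<omega>) {..<m}"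
    using brownian unfolding standard_brownian_motion_def by blast
  note spec[OF this, of "\<lambda>j. real j / real n"]
  ultimately have "indep_vars (\<lambda>_. borel) (\<lambda>j \<omega>. W (real (Suc j) / real n) \<omega> - W (real j / real n) \<omega>) {..<m}"
    by simp
  from indep_vars_compose2[OF this, of "\<lambda>_ x. 2 * x" "\<lambda>_. borel"]
  show ?thesis by (simp add: grid_increment_def[abs_def])
qed

lemma sum_grid_increment:
  assumes "\<And>i. steps n (t i) \<le> m"
  shows "(\<Sum>j<m. grid_increment n j \<omega> *\<^sub>R increment_direction n t j) = grid_marginals n t \<omega>"
  unfolding grid_increment_def grid_marginals_def
  using sum_increment_direction[OF assms, where x = "\<lambda>j. W (real j / real n) \<omega>" and c = 2] by simp

lemma expectation_grid_marginals_tendsto: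
  fixes \<phi> :: "real ^ 's \<Rightarrow> real"
  assumes t_nonneg: "\<And>i. 0 \<le> t i" and \<phi>: "continuous_on UNIV \<phi>" "\<And>x. \<bar>\<phi> x\<bar> \<le> B" and y_lim: "y \<longlonglongrightarrow> x"
  shows "(\<lambda>n. expectation (\<lambda>\<omega>. \<phi> (y n + grid_marginals n t \<omega>)))
    \<longlonglongrightarrow> expectation (\<lambda>\<omega>. \<phi> (x + (\<chi> i. 2 * W (t i) \<omega>)))"
proof (rule integral_dominated_convergence[where w = "\<lambda>_. B"])
  have \<phi>_measurable: "\<phi> \<in> borel_measurable borel" by (rule borel_measurable_continuous_onI[OF \<phi>(1)])
  show "(\<lambda>\<omega>. \<phi> (x + (\<chi> i. 2 * W (t i) \<omega>))) \<in> borel_measurable N"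
    using t_nonneg by (intro measurable_compose[OF _ \<phi>_measurable] borel_measurable_add borel_measurable_vec_lambda) auto
  show "(\<lambda>\<omega>. \<phi> (y n + grid_marginals n t \<omega>)) \<in> borel_measurable N" for n
    unfolding grid_marginals_def
    by (intro measurable_compose[OF _ \<phi>_measurable] borel_measurable_add borel_measurable_vec_lambda) auto
  have "AE \<omega> in N. W 0 \<omega> = 0" "AE \<omega> in N. continuous_on {0..} (\<lambda>t. W t \<omega>)"
    using brownian by (auto simp: standard_brownian_motion_def)
  then show "AE \<omega> in N. (\<lambda>n. \<phi> (y n + grid_marginals n t \<omega>)) \<longlonglongrightarrow> \<phi> (x + (\<chi> i. 2 * W (t i) \<omega>))"
  proof eventually_elim
    case (elim \<omega>)
    have "(\<lambda>n. W (real (steps n (t i)) / real n) \<omega>) \<longlonglongrightarrow> W (t i) \<omega>" for i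
      using t_nonneg[of i] by (intro continuous_on_tendsto_compose[OF elim(2) steps_divide_tendsto]) auto
    then have "(\<lambda>n. y n + grid_marginals n t \<omega>) \<longlonglongrightarrow> x + (\<chi> i. 2 * (W (t i) \<omega> - 0))"
      unfolding grid_marginals_def elim(1) by (intro tendsto_intros y_lim)
    from continuous_on_tendsto_compose[OF \<phi>(1) this] show ?case by simp
  qed
qed (auto intro: \<phi>(2))

end

lemma (in prob_space) Fubini_window:
  fixes f :: "'a \<Rightarrow> real \<Rightarrow> real"
  assumes f: "case_prod f \<in> borel_measurable (M \<Otimes>\<^sub>M lborel)"
    and bound: "\<And>\<omega> x. \<bar>f \<omega> x\<bar> \<le> B * indicator {u \<omega> - R..u \<omega> + R} x" and R_nonneg: "R \<ge> 0"
  shows "(LINT x|lborel. expectation (\<lambda>\<omega>. f \<omega> x)) = expectation (\<lambda>\<omega>. LINT x|lborel. f \<omega> x)"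
proof -
  interpret P: pair_sigma_finite M lborel ..
  have window: "has_bochner_integral lborel (\<lambda>x. B * indicator {u \<omega> - R..u \<omega> + R} x) (B * (2 * R))" for \<omega>
    using R_nonneg has_bochner_integral_real_indicator[of "{u \<omega> - R..u \<omega> + R}" lborel]
    by (intro has_bochner_integral_mult_right) simp
  have int: "integrable lborel (f \<omega>)" if "\<omega> \<in> space M" for \<omega>
    using bound[of \<omega>] measurable_Pair2[OF f that]
    by (intro Bochner_Integration.integrable_bound[OF integrable.intros[OF window[of \<omega>]]])
      (auto intro: order_trans[OF _ abs_ge_self])
  have "integrable (M \<Otimes>\<^sub>M lborel) (case_prod f)"
  proof (rule P.Fubini_integrable[OF f])
    show "integrable M (\<lambda>\<omega>. LINT x|lborel. norm (case_prod f (\<omega>, x)))"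
    proof (rule integrable_const_bound[of _ "B * (2 * R)"])
      have "(LINT x|lborel. norm (f \<omega> x)) \<le> B * (2 * R)" if "\<omega> \<in> space M" for \<omega>
        unfolding has_bochner_integral_integral_eq[OF window[of \<omega>], symmetric]
        using bound int[OF that] by (intro integral_mono integrable.intros[OF window]) auto
      then show "AE \<omega> in M. norm (LINT x|lborel. norm (case_prod f (\<omega>, x))) \<le> B * (2 * R)"
        by (intro AE_I2) simp
      show "(\<lambda>\<omega>. LINT x|lborel. norm (case_prod f (\<omega>, x))) \<in> borel_measurable M"
        using f by measurable
    qed
  qed (use int in \<open>auto intro!: AE_I2\<close>)
  then show ?thesis by (rule P.Fubini_integral)
qed

lemma (in prob_space) integral_translate_coordinate:
  fixes \<phi> :: "real ^ 's \<Rightarrow> real" and V :: "'s \<Rightarrow> 'a \<Rightarrow> real"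
  assumes \<phi>: "\<phi> \<in> borel_measurable borel" "\<And>x. \<bar>\<phi> x\<bar> \<le> B * of_bool (\<bar>x $ i\<^sub>0\<bar> \<le> R)" and R_nonneg: "R \<ge> 0"
    and V_measurable: "\<And>i. V i \<in> borel_measurable M"
  shows "(LINT x|lborel. expectation (\<lambda>\<omega>. \<phi> (x *\<^sub>R axis i\<^sub>0 1 + (\<chi> i. V i \<omega>))))
    = (LINT x|lborel. expectation (\<lambda>\<omega>. \<phi> (\<chi> i. if i = i\<^sub>0 then x else V i \<omega>)))"
proof -
  note V_measurable[measurable]
  let ?f = "\<lambda>\<omega> x. \<phi> (x *\<^sub>R axis i\<^sub>0 1 + (\<chi> i. V i \<omega>))"
  let ?g = "\<lambda>\<omega> x. \<phi> (\<chi> i. if i = i\<^sub>0 then x else V i \<omega>)"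
  have "(LINT x|lborel. expectation (\<lambda>\<omega>. ?f \<omega> x)) = expectation (\<lambda>\<omega>. LINT x|lborel. ?f \<omega> x)"
  proof (rule Fubini_window[OF _ _ R_nonneg, where u = "\<lambda>\<omega>. - V i\<^sub>0 \<omega>" and B = B])
    have "(\<lambda>p. snd p *\<^sub>R axis i\<^sub>0 1 + (\<chi> i. V i (fst p))) \<in> borel_measurable (M \<Otimes>\<^sub>M lborel)"
      by (intro borel_measurable_add borel_measurable_scaleR borel_measurable_vec_lambda) simp_all
    from measurable_compose[OF this \<phi>(1)]
    show "case_prod ?f \<in> borel_measurable (M \<Otimes>\<^sub>M lborel)" by (simp add: case_prod_beta')
    show "\<bar>?f \<omega> x\<bar> \<le> B * indicator {- V i\<^sub>0 \<omega> - R..- V i\<^sub>0 \<omega> + R} x" for \<omega> x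
      by (rule order_trans[OF \<phi>(2)]) (auto simp: axis_def indicator_def abs_le_iff)
  qed
  also have "\<dots> = expectation (\<lambda>\<omega>. LINT x|lborel. ?g \<omega> x)"
  proof (rule Bochner_Integration.integral_cong[OF refl])
    fix \<omega>
    have "x *\<^sub>R axis i\<^sub>0 1 + (\<chi> i. V i \<omega>) = (\<chi> i. if i = i\<^sub>0 then V i\<^sub>0 \<omega> + 1 * x else V i \<omega>)" for x
      by (simp add: vec_eq_iff axis_def)
    then show "(LINT x|lborel. ?f \<omega> x) = (LINT x|lborel. ?g \<omega> x)"
      using lborel_integral_real_affine[of 1 "?g \<omega>" "V i\<^sub>0 \<omega>"] by simp
  qed
  also have "\<dots> = (LINT x|lborel. expectation (\<lambda>\<omega>. ?g \<omega> x))"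
  proof (rule Fubini_window[OF _ _ R_nonneg, where u = "\<lambda>\<omega>. 0" and B = B, symmetric])
    have "(\<lambda>p. \<chi> i. if i = i\<^sub>0 then snd p else V i (fst p)) \<in> borel_measurable (M \<Otimes>\<^sub>M lborel)"
      by (intro borel_measurable_vec_lambda) simp
    from measurable_compose[OF this \<phi>(1)]
    show "case_prod ?g \<in> borel_measurable (M \<Otimes>\<^sub>M lborel)" by (simp add: case_prod_beta')
    show "\<bar>?g \<omega> x\<bar> \<le> B * indicator {0 - R..0 + R} x" for \<omega> x
      by (rule order_trans[OF \<phi>(2)]) (auto simp: indicator_def abs_le_iff)
  qed
  finally show ?thesis .
qed

subsection \<open>The walk from a level\<close>

context coordinate_flip_walk
begin

definition marginals :: "nat \<Rightarrow> 's::finite \<Rightarrow> ('s \<Rightarrow> real) \<Rightarrow> 'a \<Rightarrow> real ^ 's" where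
  "marginals n i\<^sub>0 t \<omega> = (\<chi> i. (X (steps n (t i)) \<omega> - (if i = i\<^sub>0 then 0 else X 0 \<omega>)) / sqrt (real n))"

lemma marginals_eq_sum:
  assumes "\<And>i. steps n (t i) \<le> m"
  shows "marginals n i\<^sub>0 t \<omega> = (X 0 \<omega> / sqrt (real n)) *\<^sub>R axis i\<^sub>0 1
      + (\<Sum>j<m. (1 / sqrt (real n) * (X (Suc j) \<omega> - X j \<omega>)) *\<^sub>R increment_direction n t j)"
  unfolding sum_increment_direction[OF assms, where x = "\<lambda>j. X j \<omega>"]
  by (simp add: marginals_def vec_eq_iff axis_def diff_divide_distrib)

lemma adapted_marginals:
  assumes "\<And>i. t i \<le> T"
  shows "adapted (steps n T) (\<lambda>\<omega>. \<phi> (marginals n i\<^sub>0 t \<omega>))"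
  using steps_mono[OF assms] by (simp add: adapted_def marginals_def X_def cong: if_cong)

lemma expectation_start_level:
  fixes F :: "real \<Rightarrow> real"
  assumes "AE \<omega> in M. X 0 \<omega> = k"
  shows "expectation (\<lambda>\<omega>. F (X 0 \<omega>)) = F k"
proof -
  have "expectation (\<lambda>\<omega>. F (X 0 \<omega>)) = expectation (\<lambda>\<omega>. F k)"
    using assms
    by (intro integral_cong_AE borel_measurable_integrable adapted_integrable[of 0])
      (auto simp: adapted_def X_def elim: eventually_mono)
  then show ?thesis by (simp add: prob_space)
qed

lemma first_moment_from_level:
  assumes start: "AE \<omega> in M. X 0 \<omega> = k" and "real j \<le> T"
  shows "expectation (\<lambda>\<omega>. \<bar>X j \<omega>\<bar>) \<le> \<bar>k\<bar> + 2 * sqrt T"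
proof -
  have "expectation (\<lambda>\<omega>. \<bar>X j \<omega>\<bar>) \<le> \<bar>k\<bar> + 2 * sqrt (real j)"
    using first_moment_le[of j] expectation_start_level[OF start, of abs] by simp
  also have "\<dots> \<le> \<bar>k\<bar> + 2 * sqrt T" using assms(2) by simp
  finally show ?thesis .
qed

lemma expectation_tail_bound:
  fixes n T R :: real
  assumes start: "AE \<omega> in M. X 0 \<omega> = k"
    and n_pos: "n > 0" and i_le: "real i \<le> T * n" and contraction: "(1 - 2 / real K) ^ i \<ge> 1 / 2"
    and Z: "adapted m Z" "\<And>\<omega>. \<bar>Z \<omega>\<bar> \<le> B * of_bool (\<bar>X i \<omega>\<bar> \<le> R * sqrt n)" and "B \<ge> 0"
  shows "\<bar>expectation Z\<bar> * (1 + k\<^sup>2 / n) \<le> B * (1 + 8 * R\<^sup>2 + 32 * T)"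
proof -
  let ?w = "\<lambda>\<omega>. 1 + (X 0 \<omega>)\<^sup>2 / n" and ?I = "\<lambda>\<omega>. of_bool (\<bar>X i \<omega>\<bar> \<le> R * sqrt n) :: real"
  have past_cong: "Z \<omega> = Z \<omega>' \<and> X i \<omega> = X i \<omega>' \<and> X 0 \<omega> = X 0 \<omega>'"
    if "\<forall>j\<le>max m i. Y j \<omega> = Y j \<omega>'" for \<omega> \<omega>'
    using Z(1) that by (simp add: adapted_def X_def)
  have int: "integrable M (\<lambda>\<omega>. Z \<omega> * ?w \<omega>)" "integrable M (\<lambda>\<omega>. Z \<omega> * (1 + k\<^sup>2 / n))"
      "integrable M (\<lambda>\<omega>. B * (?I \<omega> * ?w \<omega>))"
    by (rule adapted_integrable[of "max m i"], unfold adapted_def, metis past_cong)+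
  have "expectation (\<lambda>\<omega>. Z \<omega> * (1 + k\<^sup>2 / n)) = expectation (\<lambda>\<omega>. Z \<omega> * ?w \<omega>)"
    using start int by (intro integral_cong_AE) (auto elim: eventually_mono)
  then have "\<bar>expectation Z\<bar> * (1 + k\<^sup>2 / n) = \<bar>expectation (\<lambda>\<omega>. Z \<omega> * ?w \<omega>)\<bar>"
    using n_pos abs_mult[of "expectation Z" "1 + k\<^sup>2 / n"] by simp
  also have "\<dots> \<le> expectation (\<lambda>\<omega>. B * (?I \<omega> * ?w \<omega>))"
  proof (rule abs_integral_le_integral[OF int(1,3)])
    fix \<omega>
    have "0 \<le> ?w \<omega>" using n_pos by simp
    then show "\<bar>Z \<omega> * ?w \<omega>\<bar> \<le> B * (?I \<omega> * ?w \<omega>)"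
      using mult_right_mono[OF Z(2)[of \<omega>]] by (simp add: abs_mult mult.assoc)
  qed
  also have "\<dots> \<le> B * (1 + 8 * R\<^sup>2 + 32 * T)"
    using \<open>B \<ge> 0\<close> return_moment_le[OF n_pos i_le contraction, of R] by (simp add: mult_left_mono)
  finally show ?thesis .
qed

lemma expectation_brownian_approx:
  fixes \<phi> :: "real ^ 's \<Rightarrow> real"
  assumes start: "AE \<omega> in M. X 0 \<omega> = k" and brownian: "brownian_motion N W" and n_ge_1: "n \<ge> 1"
    and t: "\<And>i. 0 \<le> t i" "\<And>i. t i \<le> T"
    and regular: "\<And>S. lindeberg_regular L (\<chi> i. of_bool (i \<in> S)) \<phi>"
    and \<phi>: "\<phi> \<in> borel_measurable borel" "\<And>x. \<bar>\<phi> x\<bar> \<le> B"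
  shows "\<bar>expectation (\<lambda>\<omega>. \<phi> (marginals n i\<^sub>0 t \<omega>))
      - (LINT \<omega>|N. \<phi> ((k / sqrt (real n)) *\<^sub>R axis i\<^sub>0 1 + brownian_motion.grid_marginals W n t \<omega>))\<bar>
    \<le> T * L * (2 * (\<bar>k\<bar> / sqrt (real n) + 2 * sqrt T) * (real n / real K) + 12 / sqrt (real n))"
proof -
  interpret W: brownian_motion N W by (rule brownian)
  define m r b where "m = steps n T" and "r = 1 / sqrt (real n)" and "b = \<bar>k\<bar> + 2 * sqrt (T * real n)"
  have T_nonneg: "T \<ge> 0" using t order_trans by blast
  have steps_le_m: "steps n (t i) \<le> m" for i unfolding m_def by (rule steps_mono[OF t(2)])
  have m_le: "real m \<le> T * real n" unfolding m_def by (rule steps_le[OF T_nonneg])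
  have direction_regular: "lindeberg_regular L (increment_direction n t j) \<phi>" for j
    using regular[of "{i. j < steps n (t i)}"] by (simp add: increment_direction_def)
  have moment: "expectation (\<lambda>\<omega>. \<bar>X j \<omega>\<bar>) \<le> b" if "j < m" for j
    unfolding b_def using that m_le by (intro first_moment_from_level[OF start]) linarith
  have "\<bar>expectation (\<lambda>\<omega>. \<phi> (marginals n i\<^sub>0 t \<omega>))
      - expectation (\<lambda>\<omega>. LINT \<omega>'|N. \<phi> ((X 0 \<omega> / sqrt (real n)) *\<^sub>R axis i\<^sub>0 1 + W.grid_marginals n t \<omega>'))\<bar>
    \<le> real m * (2 * L * r / real K * b + 12 * L * r ^ 3)"
    unfolding marginals_eq_sum[OF steps_le_m] W.sum_grid_increment[OF steps_le_m, symmetric]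
    unfolding r_def using n_ge_1
    by (intro lindeberg_exchange[OF W.prob_space_axioms W.grid_increment_indep W.grid_increment_distributed
          _ direction_regular \<phi> moment]) auto
  also have "expectation (\<lambda>\<omega>. LINT \<omega>'|N. \<phi> ((X 0 \<omega> / sqrt (real n)) *\<^sub>R axis i\<^sub>0 1 + W.grid_marginals n t \<omega>'))
      = (LINT \<omega>'|N. \<phi> ((k / sqrt (real n)) *\<^sub>R axis i\<^sub>0 1 + W.grid_marginals n t \<omega>'))"
    by (rule expectation_start_level[OF start])
  also have "real m * (2 * L * r / real K * b + 12 * L * r ^ 3)
      \<le> (T * real n) * (2 * L * r / real K * b + 12 * L * r ^ 3)"
    using lindeberg_regular_nonneg[OF regular] T_nonneg by (intro mult_right_mono m_le) (auto simp: b_def r_def)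
  also have "\<dots> = T * L * (2 * (r * b) * (real n / real K) + 12 * (real n * r ^ 3))"
    by (simp add: algebra_simps)
  also have "r * b = \<bar>k\<bar> / sqrt (real n) + 2 * sqrt T"
    using n_ge_1 by (simp add: r_def b_def real_sqrt_mult field_simps)
  also have "real n * r ^ 3 = 1 / sqrt (real n)"
    using n_ge_1 by (simp add: r_def power3_eq_cube field_simps)
  finally show ?thesis by simp
qed

end

lemma (in prob_space) integral_uniform_measure:
  fixes f :: "'a \<Rightarrow> real"
  assumes A_pos: "A \<in> events" "prob A > 0" and f: "f \<in> borel_measurable M"
  shows "integral\<^sup>L (uniform_measure M A) f = expectation (\<lambda>\<omega>. indicator A \<omega> * f \<omega>) / prob A"
proof -
  have "uniform_measure M A = density M (\<lambda>\<omega>. ennreal (indicator A \<omega> / prob A))"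
    unfolding uniform_measure_def
    using A_pos(2) by (intro arg_cong[where f = "density M"] ext)
      (simp add: emeasure_eq_measure divide_ennreal flip: ennreal_indicator)
  then show ?thesis
    using A_pos f by (simp add: integral_density)
qed

locale uniform_hypercube_walk = coordinate_flip_walk +
  assumes Y_start: "distr M (count_space (hypercube K)) (Y 0) = uniform_count_measure (hypercube K)"
begin

definition level :: "nat \<Rightarrow> 'a set" where
  "level j = {\<omega> \<in> space M. X 0 \<omega> = 2 * real j - real K}"

definition level_mean :: "nat \<Rightarrow> ('a \<Rightarrow> real) \<Rightarrow> real" where
  "level_mean j Z = integral\<^sup>L (uniform_measure M (level j)) Z"

lemma level_eq_vimage: "level j = Y 0 -` {v \<in> hypercube K. coord_sum K v = 2 * real j - real K} \<inter> space M"
  by (auto simp: level_def X_def Y_in)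

lemma level_events: "level j \<in> events"
  unfolding level_eq_vimage by (rule measurable_sets[OF Y_measurable]) auto

lemma prob_level: "prob (level j) = real (K choose j) / 2 ^ K"
proof -
  have "prob (level j) = measure (distr M (count_space (hypercube K)) (Y 0))
      {v \<in> hypercube K. coord_sum K v = 2 * real j - real K}"
    unfolding level_eq_vimage by (rule measure_distr[OF Y_measurable, symmetric]) auto
  then show ?thesis
    unfolding Y_start by (subst (asm) measure_uniform_count_measure) (auto simp: card_hypercube card_hypercube_level)
qed

lemma prob_level_pos: "j \<le> K \<Longrightarrow> prob (level j) > 0"
  by (simp add: prob_level)

lemma expectation_eq_sum_levels:
  assumes Z_integrable: "integrable M Z"
  shows "expectation Z = (\<Sum>j\<le>K. real (K choose j) / 2 ^ K * level_mean j Z)"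
proof -
  have partition: "Z \<omega> = (\<Sum>j\<le>K. indicator (level j) \<omega> * Z \<omega>)" if \<omega>: "\<omega> \<in> space M" for \<omega>
  proof -
    let ?c = "card (plus_coordinates K (Y 0 \<omega>))"
    have "(\<Sum>j\<le>K. indicator (level j) \<omega> * Z \<omega>) = (\<Sum>j\<le>K. if j = ?c then Z \<omega> else 0)"
      using \<omega> coord_sum_eq_card_plus_coordinates[OF Y_in[OF \<omega>, of 0]]
      by (intro sum.cong) (auto simp: level_def X_def indicator_def)
    then show ?thesis using card_plus_coordinates_le by simp
  qed
  have "expectation Z = expectation (\<lambda>\<omega>. \<Sum>j\<le>K. indicator (level j) \<omega> * Z \<omega>)"
    using partition by (intro Bochner_Integration.integral_cong) auto
  also have "\<dots> = (\<Sum>j\<le>K. expectation (\<lambda>\<omega>. indicator (level j) \<omega> * Z \<omega>))"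
    using integrable_mult_indicator[OF level_events Z_integrable] by (intro Bochner_Integration.integral_sum) simp
  also have "\<dots> = (\<Sum>j\<le>K. prob (level j) * level_mean j Z)"
    using prob_level_pos Z_integrable
    by (intro sum.cong refl) (auto simp: level_mean_def integral_uniform_measure[OF level_events] less_imp_neq[symmetric])
  finally show ?thesis by (simp add: prob_level)
qed

lemma
  assumes "j \<le> K"
  shows level_walk: "coordinate_flip_walk (uniform_measure M (level j)) K Y C"
    and AE_level: "AE \<omega> in uniform_measure M (level j). X 0 \<omega> = 2 * real j - real K"
proof -
  have level_eq: "{\<omega> \<in> space M. Y 0 \<omega> \<in> {v. coord_sum K v = 2 * real j - real K}} = level j"
    by (auto simp: level_def X_def)
  show "coordinate_flip_walk (uniform_measure M (level j)) K Y C"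
    using coordinate_flip_walk_conditioned[of "{v. coord_sum K v = 2 * real j - real K}"] prob_level_pos[OF assms]
    unfolding level_eq by blast
  show "AE \<omega> in uniform_measure M (level j). X 0 \<omega> = 2 * real j - real K"
    by (rule AE_uniform_measureI[OF level_events]) (auto simp: level_def)
qed

lemma level_mean_tail_bound:
  fixes n T R :: real
  assumes "j \<le> K" "n > 0" "real i \<le> T * n" "(1 - 2 / real K) ^ i \<ge> 1 / 2"
    and "adapted m Z" "\<And>\<omega>. \<bar>Z \<omega>\<bar> \<le> B * of_bool (\<bar>X i \<omega>\<bar> \<le> R * sqrt n)" "B \<ge> 0"
  shows "\<bar>level_mean j Z\<bar> * (1 + (2 * real j - real K)\<^sup>2 / n) \<le> B * (1 + 8 * R\<^sup>2 + 32 * T)"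
  unfolding level_mean_def
  by (rule coordinate_flip_walk.expectation_tail_bound[OF level_walk[OF assms(1)] AE_level[OF assms(1)] assms(2-7)])

lemma level_mean_brownian_approx:
  fixes \<phi> :: "real ^ 's \<Rightarrow> real"
  assumes "j \<le> K" and "brownian_motion N W" and "n \<ge> 1" and "\<And>i. 0 \<le> t i" "\<And>i. t i \<le> T"
    and "\<And>S. lindeberg_regular L (\<chi> i. of_bool (i \<in> S)) \<phi>"
    and "\<phi> \<in> borel_measurable borel" "\<And>x. \<bar>\<phi> x\<bar> \<le> B"
  defines "k \<equiv> 2 * real j - real K"
  shows "\<bar>level_mean j (\<lambda>\<omega>. \<phi> (marginals n i\<^sub>0 t \<omega>))
      - (LINT \<omega>|N. \<phi> ((k / sqrt (real n)) *\<^sub>R axis i\<^sub>0 1 + brownian_motion.grid_marginals W n t \<omega>))\<bar>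
    \<le> T * L * (2 * (\<bar>k\<bar> / sqrt (real n) + 2 * sqrt T) * (real n / real K) + 12 / sqrt (real n))"
  unfolding level_mean_def k_def
  by (rule coordinate_flip_walk.expectation_brownian_approx[OF level_walk[OF assms(1)] AE_level[OF assms(1)] assms(2-8)])

end

subsection \<open>The scaling limit\<close>

lemma eventually_power_steps_ge_half:
  assumes K_lim: "filterlim K at_top sequentially" and nK_lim: "(\<lambda>n. real n / real (K n)) \<longlonglongrightarrow> 0"
    and s_nonneg: "0 \<le> s"
  shows "\<forall>\<^sub>F n in sequentially. (1 - 2 / real (K n)) ^ steps n s \<ge> 1 / 2"
proof -
  have "(\<lambda>n. s * (real n / real (K n))) \<longlonglongrightarrow> s * 0" by (intro tendsto_intros nK_lim)
  then have "\<forall>\<^sub>F n in sequentially. s * (real n / real (K n)) < 1 / 4"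
    by (rule order_tendstoD) simp
  moreover have "\<forall>\<^sub>F n in sequentially. K n \<ge> 2" using K_lim by (simp add: filterlim_at_top)
  ultimately show ?thesis
  proof eventually_elim
    case (elim n)
    have "real (steps n s) / real (K n) \<le> s * real n / real (K n)"
      by (intro divide_right_mono steps_le s_nonneg) simp
    also have "\<dots> \<le> 1 / 4" using elim(1) by simp
    finally have "real (steps n s) / real (K n) \<le> 1 / 4" .
    moreover have "real (steps n s) * (- 2 / real (K n)) = - 2 * (real (steps n s) / real (K n))" by simp
    ultimately have "1 / 2 \<le> 1 + real (steps n s) * (- 2 / real (K n))" by linarith
    also have "\<dots> \<le> (1 + (- 2 / real (K n))) ^ steps n s"
      using elim(2) by (intro Bernoulli_inequality) (simp add: field_simps)
    finally show ?case by simp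
  qed
qed

locale hypercube_walk_scaling = brownian_motion N W for N :: "'b measure" and W +
  fixes M :: "nat \<Rightarrow> 'a measure" and K :: "nat \<Rightarrow> nat"
    and Y :: "nat \<Rightarrow> nat \<Rightarrow> 'a \<Rightarrow> nat \<Rightarrow> real" and C :: "nat \<Rightarrow> nat \<Rightarrow> 'a \<Rightarrow> nat"
    and t :: "'s::finite \<Rightarrow> real" and i\<^sub>0 :: 's and \<phi> :: "real ^ 's \<Rightarrow> real"
  assumes walks: "uniform_hypercube_walk (M n) (K n) (Y n) (C n)"
    and K_lim: "filterlim K at_top sequentially"
    and nK_lim: "(\<lambda>n. real n / real (K n)) \<longlonglongrightarrow> 0"
    and t_nonneg: "0 \<le> t i"
    and \<phi>_smooth: "smooth_compact_support \<phi>"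
begin

sublocale walk: uniform_hypercube_walk "M n" "K n" "Y n" "C n" for n
  by (rule walks)

abbreviation \<phi>_marginals :: "nat \<Rightarrow> 'a \<Rightarrow> real" where
  "\<phi>_marginals n \<omega> \<equiv> \<phi> (walk.marginals n n i\<^sub>0 t \<omega>)"

lemma \<phi>_measurable: "\<phi> \<in> borel_measurable borel"
  by (rule borel_measurable_continuous_onI[OF smooth_compact_support_continuous[OF \<phi>_smooth]])

lemma \<phi>_window:
  obtains B R where "B \<ge> 0" "R \<ge> 0" "\<And>x i. \<bar>\<phi> x\<bar> \<le> B * of_bool (\<bar>x $ i\<bar> \<le> R)"
proof -
  obtain B where \<phi>_le_B: "\<And>x. \<bar>\<phi> x\<bar> \<le> B"
    using dir_deriv_bounded[OF \<phi>_smooth, of 0 0] by auto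
  obtain R where norm_le_R: "\<And>x. \<phi> x \<noteq> 0 \<Longrightarrow> norm x \<le> R"
    using smooth_compact_support_bounded_support[OF \<phi>_smooth] by blast
  have "B \<ge> 0" using \<phi>_le_B[of 0] by simp
  moreover have "\<bar>\<phi> x\<bar> \<le> B * of_bool (\<bar>x $ i\<bar> \<le> max R 0)" for x i
    using \<phi>_le_B[of x] norm_le_R[of x] component_le_norm_cart[of x i] by (cases "\<phi> x = 0") auto
  ultimately show thesis using that[of B "max R 0"] by simp
qed

definition horizon :: real where
  "horizon = (\<Sum>i\<in>UNIV. t i)"

lemma t_le_horizon: "t i \<le> horizon"
  unfolding horizon_def by (rule member_le_sum) (auto simp: t_nonneg)

lemma level_mean_tail:
  obtains A where "A \<ge> 0" "\<forall>\<^sub>F n in sequentially. \<forall>j\<le>K n. \<bar>walk.level_mean n j (\<phi>_marginals n)\<bar>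
    \<le> A * inverse (1 + ((2 * real j - real (K n)) / sqrt (real n))\<^sup>2)"
proof -
  obtain B R where B_nonneg: "B \<ge> 0" and \<phi>_le: "\<And>x i. \<bar>\<phi> x\<bar> \<le> B * of_bool (\<bar>x $ i\<bar> \<le> R)" using \<phi>_window by metis
  have horizon_nonneg: "horizon \<ge> 0" using t_le_horizon t_nonneg order_trans by blast
  define A where "A = B * (1 + 8 * R\<^sup>2 + 32 * horizon)"
  show thesis
  proof
    show "A \<ge> 0" using B_nonneg horizon_nonneg by (simp add: A_def)
    show "\<forall>\<^sub>F n in sequentially. \<forall>j\<le>K n. \<bar>walk.level_mean n j (\<phi>_marginals n)\<bar>
        \<le> A * inverse (1 + ((2 * real j - real (K n)) / sqrt (real n))\<^sup>2)"
      using eventually_power_steps_ge_half[OF K_lim nK_lim t_nonneg[of i\<^sub>0]] eventually_ge_at_top[of 1]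
    proof eventually_elim
      case (elim n)
      have steps_le_horizon: "real (steps n (t i\<^sub>0)) \<le> horizon * real n"
        using steps_le[OF t_nonneg] t_le_horizon by (rule order_trans[OF _ mult_right_mono]) simp
      have window: "\<bar>\<phi>_marginals n \<omega>\<bar> \<le> B * of_bool (\<bar>walk.X n (steps n (t i\<^sub>0)) \<omega>\<bar> \<le> R * sqrt (real n))" for \<omega>
        using \<phi>_le[of "walk.marginals n n i\<^sub>0 t \<omega>" i\<^sub>0] elim(2)
        by (simp add: walk.marginals_def divide_le_eq)
      show ?case
      proof (intro allI impI)
        fix j assume j_le: "j \<le> K n"
        have "\<bar>walk.level_mean n j (\<phi>_marginals n)\<bar> * (1 + (2 * real j - real (K n))\<^sup>2 / real n) \<le> A"
          unfolding A_def using elim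
          by (intro walk.level_mean_tail_bound[OF j_le _ steps_le_horizon _ walk.adapted_marginals[OF t_le_horizon] window B_nonneg]) auto
        then show "\<bar>walk.level_mean n j (\<phi>_marginals n)\<bar>
            \<le> A * inverse (1 + ((2 * real j - real (K n)) / sqrt (real n))\<^sup>2)"
          by (simp add: power_divide add_pos_nonneg pos_le_divide_eq flip: divide_inverse)
      qed
    qed
  qed
qed

lemma level_mean_tendsto:
  assumes j_le: "\<forall>\<^sub>F n in sequentially. j n \<le> K n"
    and x_lim: "(\<lambda>n. (2 * real (j n) - real (K n)) / sqrt (real n)) \<longlonglongrightarrow> x"
  shows "(\<lambda>n. walk.level_mean n (j n) (\<phi>_marginals n))
    \<longlonglongrightarrow> expectation (\<lambda>\<omega>. \<phi> (x *\<^sub>R axis i\<^sub>0 1 + (\<chi> i. 2 * W (t i) \<omega>)))"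
proof -
  obtain B where \<phi>_bounded: "\<And>x. \<bar>\<phi> x\<bar> \<le> B"
    using dir_deriv_bounded[OF \<phi>_smooth, of 0 0] by auto
  obtain L where L_regular: "\<And>S. lindeberg_regular L (\<chi> i. of_bool (i \<in> S)) \<phi>"
    using smooth_compact_support_lindeberg_regular_indicator[OF \<phi>_smooth] by blast
  define y where "y n = (2 * real (j n) - real (K n)) / sqrt (real n)" for n
  define I where "I n = expectation (\<lambda>\<omega>. \<phi> (y n *\<^sub>R axis i\<^sub>0 1 + grid_marginals n t \<omega>))" for n
  have y_lim: "y \<longlonglongrightarrow> x" using x_lim by (simp add: y_def[abs_def])
  have I_lim: "I \<longlonglongrightarrow> expectation (\<lambda>\<omega>. \<phi> (x *\<^sub>R axis i\<^sub>0 1 + (\<chi> i. 2 * W (t i) \<omega>)))"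
    unfolding I_def
    by (rule expectation_grid_marginals_tendsto[OF t_nonneg smooth_compact_support_continuous[OF \<phi>_smooth] \<phi>_bounded
          tendsto_scaleR[OF y_lim tendsto_const]])
  have "(\<lambda>n. walk.level_mean n (j n) (\<phi>_marginals n) - I n) \<longlonglongrightarrow> 0"
  proof (rule Lim_null_comparison)
    let ?E = "\<lambda>n. horizon * L * (2 * (\<bar>y n\<bar> + 2 * sqrt horizon) * (real n / real (K n)) + 12 / sqrt (real n))"
    show "\<forall>\<^sub>F n in sequentially. norm (walk.level_mean n (j n) (\<phi>_marginals n) - I n) \<le> ?E n"
      using j_le eventually_ge_at_top[of 1]
    proof eventually_elim
      case (elim n)
      show ?case
        using walk.level_mean_brownian_approx[OF elim(1) brownian_motion_axioms elim(2) t_nonneg t_le_horizon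
            L_regular \<phi>_measurable \<phi>_bounded]
        by (simp add: I_def y_def abs_divide)
    qed
    have "(\<lambda>n. 12 / sqrt (real n)) \<longlonglongrightarrow> 0" by real_asymp
    then have "?E \<longlonglongrightarrow> horizon * L * (2 * (\<bar>x\<bar> + 2 * sqrt horizon) * 0 + 0)"
      by (intro tendsto_intros y_lim nK_lim)
    then show "?E \<longlonglongrightarrow> 0" by simp
  qed
  from tendsto_add[OF this I_lim] show ?thesis by simp
qed

theorem expectation_marginals_tendsto:
  "(\<lambda>n. sqrt (2 * pi * (real (K n) / real n)) * walk.expectation n (\<phi>_marginals n))
    \<longlonglongrightarrow> (LINT x|lborel. expectation (\<lambda>\<omega>. \<phi> (\<chi> i. if i = i\<^sub>0 then x else 2 * W (t i) \<omega>)))"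
proof -
  obtain B R where window: "R \<ge> 0" "\<And>x i. \<bar>\<phi> x\<bar> \<le> B * of_bool (\<bar>x $ i\<bar> \<le> R)" using \<phi>_window by metis
  obtain A where A_tail: "A \<ge> 0" "\<forall>\<^sub>F n in sequentially. \<forall>j\<le>K n. \<bar>walk.level_mean n j (\<phi>_marginals n)\<bar>
      \<le> A * inverse (1 + ((2 * real j - real (K n)) / sqrt (real n))\<^sup>2)"
    using level_mean_tail by blast
  have levels: "walk.expectation n (\<phi>_marginals n)
      = (\<Sum>j\<le>K n. real (K n choose j) / 2 ^ K n * walk.level_mean n j (\<phi>_marginals n))" for n
    by (rule walk.expectation_eq_sum_levels[OF walk.adapted_integrable[OF walk.adapted_marginals[OF t_le_horizon]]])
  have "(\<lambda>n. sqrt (2 * pi * (real (K n) / real n)) * walk.expectation n (\<phi>_marginals n))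
      \<longlonglongrightarrow> (LINT x|lborel. expectation (\<lambda>\<omega>. \<phi> (x *\<^sub>R axis i\<^sub>0 1 + (\<chi> i. 2 * W (t i) \<omega>))))"
    unfolding levels
    by (rule binomial_sum_tendsto_integral[OF K_lim walk.K_ge_1 nK_lim A_tail]) (rule level_mean_tendsto)
  also have "(LINT x|lborel. expectation (\<lambda>\<omega>. \<phi> (x *\<^sub>R axis i\<^sub>0 1 + (\<chi> i. 2 * W (t i) \<omega>))))
      = (LINT x|lborel. expectation (\<lambda>\<omega>. \<phi> (\<chi> i. if i = i\<^sub>0 then x else 2 * W (t i) \<omega>)))"
    using t_nonneg by (intro integral_translate_coordinate[OF \<phi>_measurable window(2,1)]) auto
  finally show ?thesis .
qed

end

lemma hypercube_walk_uniform_iff: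
  "hypercube_walk M K (uniform_count_measure (hypercube K)) Y \<longleftrightarrow> (\<exists>C. uniform_hypercube_walk M K Y C)"
  unfolding hypercube_walk_def uniform_hypercube_walk_def uniform_hypercube_walk_axioms_def
    coordinate_flip_walk_def coordinate_flip_walk_axioms_def by blast

theorem theorem4:
  fixes K :: "nat \<Rightarrow> nat"
    and M :: "nat \<Rightarrow> 'a measure"
    and Y :: "nat \<Rightarrow> nat \<Rightarrow> 'a \<Rightarrow> (nat \<Rightarrow> real)"
    and N :: "'b measure"
    and W :: "real \<Rightarrow> 'b \<Rightarrow> real"
    and t :: "'s::{finite,linorder} \<Rightarrow> real"
    and \<phi> :: "(real, 's::{finite,linorder}) vec \<Rightarrow> real"
  assumes K_pos: "\<And>n. K n \<ge> 1"
    and K_lim: "filterlim K at_top sequentially"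
    and nK_lim: "(\<lambda>n. real n / real (K n)) \<longlonglongrightarrow> 0"
    and walk: "\<And>k. k \<ge> 1 \<Longrightarrow>
                 hypercube_walk (M k) k (uniform_count_measure (hypercube k)) (Y k)"
    and BM: "standard_brownian_motion N W"
    and t_nonneg: "\<And>i. 0 \<le> t i"
    and t_mono: "strict_mono t"
    and \<phi>: "smooth_compact_support \<phi>"
  shows "(\<lambda>n. sqrt (2 * pi * (real (K n) / real n)) *
              (LINT \<omega>|M (K n). \<phi> (\<chi> i. if i = Min UNIV then walk_Z Y n (K n) (t i) \<omega>
                                        else walk_dZ Y n (K n) (t i) \<omega>)))
         \<longlonglongrightarrow> (LINT x|lborel. (LINT \<omega>|N. \<phi> (\<chi> i. if i = Min UNIV then x else 2 * W (t i) \<omega>)))"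
proof -
  obtain C where walk_C: "\<And>n. uniform_hypercube_walk (M (K n)) (K n) (Y (K n)) (C n)"
    using walk[OF K_pos] unfolding hypercube_walk_uniform_iff by metis
  interpret brownian_motion N W
    using BM by (simp add: brownian_motion_def brownian_motion_axioms_def standard_brownian_motion_def)
  interpret hypercube_walk_scaling N W "\<lambda>n. M (K n)" K "\<lambda>n. Y (K n)" C t "Min UNIV" \<phi>
    by (intro hypercube_walk_scaling.intro hypercube_walk_scaling_axioms.intro brownian_motion_axioms
        walk_C K_lim nK_lim t_nonneg \<phi>)
  have "(\<chi> i. if i = Min UNIV then walk_Z Y n (K n) (t i) \<omega> else walk_dZ Y n (K n) (t i) \<omega>)
      = walk.marginals n n (Min UNIV) t \<omega>" for n \<omega>
    by (simp add: vec_eq_iff walk.marginals_def walk.X_def walk_Z_def walk_dZ_def walk_X_def diff_divide_distrib)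
  then show ?thesis
    using expectation_marginals_tendsto by simp
qed

end
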